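(* Let $r(\theta,\theta^\ast)\ge0$ be a loss function satisfying Assumption T of the context (with constant $c>0$, rate $\varepsilon_n>0$, sieves $\mathcal F_{n,\varepsilon}$ and tests $\phi_{n,\varepsilon}$). Let $(\widehat q_\theta,\widehat q_{S^n})$ be the usual variational Bayes solution ($\alpha=1$), i.e. a minimizer of $\Psi_n$ over $\Gamma=\Gamma_\theta\times\Gamma_{S^n}$, and let $\widehat Q_\theta$ be the probability distribution with density $\widehat q_\theta$. Then for any $\varepsilon\ge\varepsilon_n$, with $\mathbb P^{(n)}_{\theta^\ast}$-probability at least $1-2e^{-c\,n\,\varepsilon_n^2/2}$, it holds simultaneously for all probability measures $q_\theta\in\Gamma_\theta$ with $q_\theta\ll p_\theta$ and all probability measures $q_{S^n}\in\Gamma_{S^n}$ on $S^n$ that $$\frac1n\bigg[\widehat Q_\theta(\mathcal F_{n,\varepsilon}^c)\log\frac{\widehat Q_\theta(\mathcal F_{n,\varepsilon}^c)}{P_\theta(\mathcal F_{n,\varepsilon}^c)}+\big(1-\widehat Q_\theta(\mathcal F_{n,\varepsilon}^c)\big)\log\frac{1-\widehat Q_\theta(\mathcal F_{n,\varepsilon}^c)}{1-P_\theta(\mathcal F_{n,\varepsilon}^c)}\bigg]+c\int_{\theta\in\mathcal F_{n,\varepsilon},\,r(\theta,\theta^\ast)\ge\varepsilon^2}r(\theta,\theta^\ast)\,\widehat q_\theta(\theta)\,d\theta$$ $$\le\ \frac1n\Psi_n(q_\theta,q_{S^n})+\frac{c\,\varepsilon_n^2}{2}+\frac{\log2}{n}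.$$
   Context: Model. The data $Y^n=(Y_1,\dots,Y_n)\in\mathcal Y^n$ have distribution $\mathbb P^{(n)}_\theta$ with density $p(Y^n\mid\theta)$, $\theta\in\Theta$. The parameter decomposes as $\theta=(\mu,\pi)$ and there is a discrete latent variable $S^n$ such that $p(Y^n\mid\theta)=\sum_{s^n}p(Y^n\mid\mu,s^n)\,\pi_{s^n}$ with $\pi_{s^n}:=p(S^n=s^n\mid\theta)$ and $p(Y^n\mid\mu,s^n)$ the conditional density of $Y^n$ given $S^n=s^n$. The prior on $\theta$ is $P_\theta$ with density $p_\theta$. The data are generated from $\mathbb P^{(n)}_{\theta^\ast}$; $\mathbb E_\theta$ denotes expectation under $\mathbb P^{(n)}_\theta$. Objective. $\Gamma=\Gamma_\theta\times\Gamma_{S^n}$ is a given family of product densities $q_\theta(\theta)q_{S^n}(s^n)$. With $D(p\,\|\,q)=\int p\log(p/q)$, $\ell_n(\theta)=\log p(Y^n\mid\theta)$, $\ell_n(\theta,\theta^\ast)=\ell_n(\theta)-\ell_n(\theta^\ast)$ and $$\Delta_J(q_\theta,q_{S^n})=\int_\Theta\Big[\ell_n(\theta)-\sum_{s^n}q_{S^n}(s^n)\log\frac{p(Y^n\mid\mu,s^n)\pi_{s^n}}{q_{S^n}(s^n)}\Big]q_\theta(d\theta),$$ set $$\Psi_n(q_\theta,q_{S^n})=-\int_\Theta\ell_n(\theta,\theta^\ast)\,q_\theta(d\theta)+\Delta_J(q_\theta,q_{S^n})+D(q_\theta\,\|\,p_\theta).$$ $(\widehat q_\theta,\widehat q_{S^n})=\arg\min_{\Gamma}\Psi_n$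 (data-dependent, assumed to exist). Assumption T (statistical identifiability). For some $\varepsilon_n>0$ and any $\varepsilon\ge\varepsilon_n$, there exist a sieve set $\mathcal F_{n,\varepsilon}\subset\Theta$ and a test function $\phi_{n,\varepsilon}:\mathcal Y^n\to[0,1]$ such that $$P_\theta(\mathcal F_{n,\varepsilon}^c)\le e^{-c\,n\,\varepsilon^2},\qquad \mathbb E_{\theta^\ast}[\phi_{n,\varepsilon}]\le e^{-c\,n\,\varepsilon_n^2},$$ $$\mathbb E_\theta[1-\phi_{n,\varepsilon}]\le e^{-c\,n\,r(\theta,\theta^\ast)}\quad\text{for all }\theta\in\mathcal F_{n,\varepsilon}\text{ with }r(\theta,\theta^\ast)\ge\varepsilon^2,$$ where $c>0$ is a constant. Convention: $0\log 0=0\log(0/0)=0$. *)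

theory Defs
  imports "HOL-Probability.Probability"
begin

text \<open>
  Log-likelihoods, relative entropies and the variational objective may be infinite, so they are
  \<open>ereal\<close>-valued.  The library's \<open>KL_divergence\<close> and the Bochner integral are real-valued and return
  \<open>0\<close> on non-integrable arguments, which would produce spurious minimizers; they are therefore not
  used here.
\<close>

definition eln :: "ennreal \<Rightarrow> ereal" where
  "eln x = (if x = 0 then - \<infinity> else if x = \<infinity> then \<infinity> else ereal (ln (enn2real x)))"

text \<open>
  Integral of an extended real function.  Since \<open>\<infinity> - \<infinity> = (\<infinity> :: ereal)\<close>, an undefined
  integral gets the value \<open>\<infinity>\<close>.
\<close>

definition ext_integral :: "'a measure \<Rightarrow> ('a \<Rightarrow> ereal) \<Rightarrow> ereal" where
  "ext_integral M f =
     enn2ereal (\<integral>\<^sup>+x. e2ennreal (f x) \<partial>M) - enn2ereal (\<integral>\<^sup>+x. e2ennreal (- f x) \<partial>M)"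

text \<open>
  \<open>a log (a / b)\<close> for \<open>a, b \<ge> 0\<close>.  The conventions of \<open>ennreal\<close> division and \<open>ereal\<close> multiplication
  give \<open>0 log (0 / b) = 0 log (0 / 0) = 0\<close>, and \<open>a log (a / 0) = \<infinity>\<close> for \<open>a > 0\<close>.
\<close>

definition xlog_ratio :: "real \<Rightarrow> real \<Rightarrow> ereal" where
  "xlog_ratio a b = ereal a * eln (ennreal a / ennreal b)"

definition prob_density :: "'a measure \<Rightarrow> ('a \<Rightarrow> real) \<Rightarrow> bool" where
  "prob_density M f \<longleftrightarrow>
     f \<in> borel_measurable M \<and> (\<forall>x\<in>space M. 0 \<le> f x) \<and> prob_space (density M (\<lambda>x. ennreal (f x)))"

abbreviation law :: "'a measure \<Rightarrow> ('a \<Rightarrow> real) \<Rightarrow> 'a measure" where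
  "law M q \<equiv> density M (\<lambda>x. ennreal (q x))"

definition rel_entropy :: "'a measure \<Rightarrow> ('a \<Rightarrow> real) \<Rightarrow> ('a \<Rightarrow> real) \<Rightarrow> ereal" where
  "rel_entropy M p q = ext_integral M (\<lambda>x. xlog_ratio (p x) (q x))"

text \<open>
  A latent variable model: \<open>\<Y>\<close> is the measurable space of one observation, \<open>\<nu>\<close> the measure on \<open>\<Y>\<^sup>n\<close>
  dominating the laws of \<open>Y\<^sup>n\<close>, and \<open>\<Lambda>\<close> the reference measure \<open>d\<theta>\<close> on the parameter space
  \<open>\<Theta> = space \<Lambda>\<close>, with \<open>\<theta> = (\<mu>, \<pi>)\<close>.  The conditional density \<open>p(y | \<mu>, s)\<close> of \<open>Y\<^sup>n\<close> given \<open>S\<^sup>n = s\<close> is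
  \<open>cond \<mu> s y\<close>, and the distribution of \<open>S\<^sup>n\<close> under \<open>\<theta>\<close> is \<open>latent \<theta>\<close>, so \<open>\<pi>\<^sub>s\<close> is \<open>pmf (latent \<theta>) s\<close>.
\<close>

locale latent_variable_model =
  fixes \<Y> :: "'y measure"
    and n :: nat
    and \<nu> :: "(nat \<Rightarrow> 'y) measure"
    and \<Lambda> :: "('m \<times> 'p) measure"
    and cond :: "'m \<Rightarrow> 's::countable \<Rightarrow> (nat \<Rightarrow> 'y) \<Rightarrow> real"
    and latent :: "'m \<times> 'p \<Rightarrow> 's pmf"
  assumes n_pos: "1 \<le> n"
    and sets_data: "sets \<nu> = sets (PiM {..<n} (\<lambda>_. \<Y>))"
    and sigma_finite_data: "sigma_finite_measure \<nu>"
    and sigma_finite_param: "sigma_finite_measure \<Lambda>"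
    and cond_nonneg: "\<And>\<theta> s y. \<theta> \<in> space \<Lambda> \<Longrightarrow> y \<in> space \<nu> \<Longrightarrow> 0 \<le> cond (fst \<theta>) s y"
    and cond_measurable:
      "\<And>s. (\<lambda>(\<theta>, y). cond (fst \<theta>) s y) \<in> borel_measurable (\<Lambda> \<Otimes>\<^sub>M \<nu>)"
    and cond_density:
      "\<And>\<theta> s. \<theta> \<in> space \<Lambda> \<Longrightarrow> s \<in> set_pmf (latent \<theta>) \<Longrightarrow> prob_density \<nu> (cond (fst \<theta>) s)"
    and latent_measurable: "\<And>s. (\<lambda>\<theta>. pmf (latent \<theta>) s) \<in> borel_measurable \<Lambda>"

text \<open>\<open>p(y | \<theta>) = \<Sum>\<^sub>s p(y | \<mu>, s) \<pi>\<^sub>s\<close>; the series may diverge on a null set of \<open>y\<close>.\<close>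

definition likelihood ::
  "('m \<Rightarrow> 's \<Rightarrow> 'd \<Rightarrow> real) \<Rightarrow> ('m \<times> 'p \<Rightarrow> 's pmf) \<Rightarrow> 'm \<times> 'p \<Rightarrow> 'd \<Rightarrow> ennreal" where
  "likelihood cond latent \<theta> y =
     (\<integral>\<^sup>+s. ennreal (cond (fst \<theta>) s y * pmf (latent \<theta>) s) \<partial>count_space UNIV)"

definition data_law ::
  "'d measure \<Rightarrow> ('m \<Rightarrow> 's \<Rightarrow> 'd \<Rightarrow> real) \<Rightarrow> ('m \<times> 'p \<Rightarrow> 's pmf) \<Rightarrow> 'm \<times> 'p \<Rightarrow> 'd measure" where
  "data_law \<nu> cond latent \<theta> = density \<nu> (likelihood cond latent \<theta>)"

definition loglik ::
  "('m \<Rightarrow> 's \<Rightarrow> 'd \<Rightarrow> real) \<Rightarrow> ('m \<times> 'p \<Rightarrow> 's pmf) \<Rightarrow> 'd \<Rightarrow> 'm \<times> 'p \<Rightarrow> ereal" where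
  "loglik cond latent y \<theta> = eln (likelihood cond latent \<theta> y)"

definition loglik_ratio ::
  "('m \<Rightarrow> 's \<Rightarrow> 'd \<Rightarrow> real) \<Rightarrow> ('m \<times> 'p \<Rightarrow> 's pmf) \<Rightarrow> 'd \<Rightarrow> 'm \<times> 'p \<Rightarrow> 'm \<times> 'p \<Rightarrow> ereal" where
  "loglik_ratio cond latent y \<theta> \<theta>star = loglik cond latent y \<theta> - loglik cond latent y \<theta>star"

text \<open>
  Where \<open>p(y | \<theta>) = 0\<close> the integrand has the form \<open>- \<infinity> - (- \<infinity>)\<close>, which is \<open>\<infinity>\<close> in \<open>ereal\<close>; the
  objective is \<open>\<infinity>\<close> there anyway, because of its first term.
\<close>

definition jensen_gap ::
  "('m \<times> 'p) measure \<Rightarrow> ('m \<Rightarrow> 's \<Rightarrow> 'd \<Rightarrow> real) \<Rightarrow> ('m \<times> 'p \<Rightarrow> 's pmf) \<Rightarrow> 'd \<Rightarrow>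
    ('m \<times> 'p \<Rightarrow> real) \<Rightarrow> 's pmf \<Rightarrow> ereal" where
  "jensen_gap \<Lambda> cond latent y q\<theta> qS =
     ext_integral (law \<Lambda> q\<theta>) (\<lambda>\<theta>. loglik cond latent y \<theta> -
       ext_integral (count_space UNIV) (\<lambda>s. ereal (pmf qS s) *
         eln (ennreal (cond (fst \<theta>) s y * pmf (latent \<theta>) s) / ennreal (pmf qS s))))"

text \<open>
  The variational objective.  In the first term the minus sign stands inside the integral so that an
  undefined integral makes the objective \<open>\<infinity>\<close> rather than \<open>- \<infinity>\<close>.
\<close>

definition vb_objective ::
  "('m \<times> 'p) measure \<Rightarrow> ('m \<Rightarrow> 's \<Rightarrow> 'd \<Rightarrow> real) \<Rightarrow> ('m \<times> 'p \<Rightarrow> 's pmf) \<Rightarrow>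
    ('m \<times> 'p \<Rightarrow> real) \<Rightarrow> 'm \<times> 'p \<Rightarrow> 'd \<Rightarrow> ('m \<times> 'p \<Rightarrow> real) \<Rightarrow> 's pmf \<Rightarrow> ereal" where
  "vb_objective \<Lambda> cond latent p\<theta> \<theta>star y q\<theta> qS =
     ext_integral (law \<Lambda> q\<theta>) (\<lambda>\<theta>. - loglik_ratio cond latent y \<theta> \<theta>star)
     + jensen_gap \<Lambda> cond latent y q\<theta> qS + rel_entropy \<Lambda> q\<theta> p\<theta>"

definition statistical_identifiability ::
  "nat \<Rightarrow> 't measure \<Rightarrow> ('t \<Rightarrow> 'd measure) \<Rightarrow> 't \<Rightarrow> ('t \<Rightarrow> 't \<Rightarrow> real) \<Rightarrow> real \<Rightarrow> real \<Rightarrow>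
    (real \<Rightarrow> 't set) \<Rightarrow> (real \<Rightarrow> 'd \<Rightarrow> real) \<Rightarrow> bool" where
  "statistical_identifiability n P\<theta> P \<theta>star r c \<epsilon>n F \<phi> \<longleftrightarrow>
     0 < c \<and> 0 < \<epsilon>n \<and>
     (\<forall>\<epsilon>\<ge>\<epsilon>n.
        F \<epsilon> \<in> sets P\<theta> \<and>
        \<phi> \<epsilon> \<in> borel_measurable (P \<theta>star) \<and>
        (\<forall>y\<in>space (P \<theta>star). 0 \<le> \<phi> \<epsilon> y \<and> \<phi> \<epsilon> y \<le> 1) \<and>
        measure P\<theta> (space P\<theta> - F \<epsilon>) \<le> exp (- c * n * \<epsilon>\<^sup>2) \<and>
        (\<integral>y. \<phi> \<epsilon> y \<partial>P \<theta>star) \<le> exp (- c * n * \<epsilon>n\<^sup>2) \<and>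
        (\<forall>\<theta>\<in>F \<epsilon>. \<epsilon>\<^sup>2 \<le> r \<theta> \<theta>star \<longrightarrow>
           (\<integral>y. (1 - \<phi> \<epsilon> y) \<partial>P \<theta>) \<le> exp (- c * n * r \<theta> \<theta>star)))"

end

theory Submission
  imports Defs
begin

text \<open>
  Let \<open>w = c n r\<close> on \<open>U = {\<theta> \<in> F. r \<ge> \<epsilon>\<^sup>2}\<close> and \<open>w = 0\<close> elsewhere, and for \<open>G = F\<close> or \<open>G = F\<^sup>c\<close> let
  \<open>I\<^sub>G(y) = \<integral>\<^sub>G p(y | \<theta>) / p(y | \<theta>\<^sup>*) exp(w) dP\<close>.  The tests satisfy \<open>E\<^sub>\<theta>[1 - \<phi>] \<le> exp(- w(\<theta>))\<close>, so Fubini gives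
  \<open>E[(1 - \<phi>) I\<^sub>G] \<le> P(G)\<close> under the truth.  With \<open>t = exp(c n \<epsilon>\<^sub>n\<^sup>2 / 2)\<close>, the indicator of the event that
  \<open>I\<^sub>G > 2 t P(G)\<close> for some \<open>G\<close> is at most \<open>\<phi> + (1 - \<phi>) (\<Sum>\<^sub>G I\<^sub>G / (2 t P(G)))\<close>; its probability is therefore
  at most \<open>1 / t\<^sup>2 + 1 / t \<le> 2 / t\<close>.  Off this event a Donsker-Varadhan argument, carried out separately
  on \<open>F\<close> and on \<open>F\<^sup>c\<close>, bounds the binary relative entropy plus \<open>\<integral> w dQ\<close> by
  \<open>- \<integral> log (p(y | \<theta>) / p(y | \<theta>\<^sup>*)) dQ + D(Q || P) + log (2 t)\<close> for every \<open>Q\<close>.  The Jensen gap is nonnegative,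
  and the minimizer may be replaced by any competitor on the right-hand side.
\<close>

section \<open>Integrals of extended real functions\<close>

text \<open>The nonnegative integral is monotone for arbitrary functions, so the comparison also
  covers the Jensen gap integrand, whose measurability is never established.\<close>

lemma ext_integral_mono_AE:
  assumes "AE x in M. f x \<le> g x"
  shows "ext_integral M f \<le> ext_integral M g"
proof -
  have "(\<integral>\<^sup>+x. e2ennreal (f x) \<partial>M) \<le> (\<integral>\<^sup>+x. e2ennreal (g x) \<partial>M)"
    using assms by (intro nn_integral_mono_AE) (auto elim!: eventually_mono intro: e2ennreal_mono)
  moreover have "(\<integral>\<^sup>+x. e2ennreal (- g x) \<partial>M) \<le> (\<integral>\<^sup>+x. e2ennreal (- f x) \<partial>M)"
    using assms by (intro nn_integral_mono_AE) (auto elim!: eventually_mono intro: e2ennreal_mono)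
  ultimately show ?thesis
    unfolding ext_integral_def by (intro ereal_minus_mono) (auto simp: less_eq_ennreal.rep_eq)
qed

lemma ext_integral_cong_AE:
  assumes "AE x in M. f x = g x"
  shows "ext_integral M f = ext_integral M g"
  using assms by (intro antisym ext_integral_mono_AE) (auto elim: eventually_mono)

lemma ext_integral_eq_integral:
  assumes "integrable M f"
  shows "ext_integral M (\<lambda>x. ereal (f x)) = ereal (\<integral>x. f x \<partial>M)"
proof -
  have "(\<integral>\<^sup>+x. ennreal (f x) \<partial>M) < \<infinity>" "(\<integral>\<^sup>+x. ennreal (- f x) \<partial>M) < \<infinity>"
    using assms by (auto simp: real_integrable_def less_top)
  then show ?thesis
    unfolding ext_integral_def
    by (cases "\<integral>\<^sup>+x. ennreal (f x) \<partial>M"; cases "\<integral>\<^sup>+x. ennreal (- f x) \<partial>M")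
      (auto simp: real_lebesgue_integral_def[OF assms] enn2ereal_ennreal)
qed

text \<open>In \<open>ereal\<close>, \<open>\<infinity> - x = \<infinity>\<close> for every
  \<open>x\<close>, so a divergent positive part forces the value \<open>\<infinity>\<close> even if
  the negative part diverges too.\<close>

lemma nn_integral_less_top_if_ext_integral:
  assumes "ext_integral M f < \<infinity>"
  shows "(\<integral>\<^sup>+x. e2ennreal (f x) \<partial>M) < \<infinity>"
  using assms unfolding ext_integral_def
  by (cases "\<integral>\<^sup>+x. e2ennreal (f x) \<partial>M") (auto simp: less_top)

text \<open>The finite extended integral controls the positive part of \<open>f\<close>, and the
  integrable minorant \<open>g\<close> controls its negative part. In this way integrability of the
  logarithmic terms is derived from finiteness of the objective instead of being assumed.\<close>

lemma integrable_if_ext_integral_less_top: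
  fixes f g :: "'a \<Rightarrow> real"
  assumes f: "f \<in> borel_measurable M" and g: "integrable M g"
    and gf: "AE x in M. g x \<le> f x"
    and fin: "ext_integral M (\<lambda>x. ereal (f x)) < \<infinity>"
  shows "integrable M f"
  unfolding real_integrable_def
proof (intro conjI f)
  show "(\<integral>\<^sup>+x. ennreal (f x) \<partial>M) \<noteq> \<infinity>"
    using nn_integral_less_top_if_ext_integral[OF fin] by (simp add: less_top)
  have "(\<integral>\<^sup>+x. ennreal (- f x) \<partial>M) \<le> (\<integral>\<^sup>+x. ennreal (- g x) \<partial>M)"
    using gf by (intro nn_integral_mono_AE) (auto elim!: eventually_mono intro!: ennreal_leI)
  then show "(\<integral>\<^sup>+x. ennreal (- f x) \<partial>M) \<noteq> \<infinity>"
    using g by (auto simp: real_integrable_def top_unique)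
qed

lemma e2ennreal_times_ereal:
  assumes "0 \<le> a"
  shows "e2ennreal (ereal a * x) = ennreal a * e2ennreal x"
proof (cases "0 \<le> x")
  case True
  then obtain y where "x = enn2ereal y"
    by (metis enn2ereal_e2ennreal)
  moreover have "ereal a = enn2ereal (ennreal a)"
    using assms by (simp add: enn2ereal_ennreal)
  ultimately show ?thesis
    by (metis e2ennreal_enn2ereal times_ennreal.rep_eq)
next
  case False
  then have "ereal a * x \<le> 0"
    using assms by (simp add: ereal_mult_le_0_iff)
  with False show ?thesis by (simp add: e2ennreal_neg)
qed

lemma ext_integral_law:
  assumes "q \<in> borel_measurable M" "f \<in> borel_measurable M" and nn: "\<And>x. x \<in> space M \<Longrightarrow> 0 \<le> q x"
  shows "ext_integral (law M q) f = ext_integral M (\<lambda>x. ereal (q x) * f x)"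
proof -
  have "(\<integral>\<^sup>+x. e2ennreal (g x) \<partial>law M q) = (\<integral>\<^sup>+x. e2ennreal (ereal (q x) * g x) \<partial>M)"
    if [measurable]: "g \<in> borel_measurable M" for g
    using assms(1) by (subst nn_integral_density) (auto intro!: nn_integral_cong simp: e2ennreal_times_ereal nn)
  from this[of f] this[of "\<lambda>x. - f x"] show ?thesis
    using assms(2) by (simp add: ext_integral_def)
qed

section \<open>The extended logarithm and \<open>a log (a / b)\<close>\<close>

lemma eln_measurable [measurable]: "eln \<in> borel_measurable borel"
  unfolding eln_def[abs_def] by measurable

lemma eln_ennreal: "0 < x \<Longrightarrow> eln (ennreal x) = ereal (ln x)"
  by (simp add: eln_def)

text \<open>Here \<open>a\<close> may be \<open>0\<close> or \<open>\<infinity>\<close>, so for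
  fixed data with \<open>p(y | \<theta>star)\<close> positive and finite the log-likelihood
  difference becomes the logarithm of a ratio at every parameter.\<close>

lemma eln_divide:
  assumes "0 < b" "b < \<infinity>"
  shows "eln (a / b) = eln a - eln b"
proof -
  obtain b' where b: "b = ennreal b'" "0 < b'"
    using assms by (cases b) (auto simp: ennreal_less_zero_iff)
  show ?thesis
  proof (cases a)
    case (real a')
    then show ?thesis using b
      by (cases "a' = 0") (auto simp: divide_ennreal eln_def ln_div)
  next
    case top
    then show ?thesis using b by (simp add: eln_def ennreal_top_divide)
  qed
qed

lemma xlog_ratio_real:
  assumes "0 \<le> a" "0 \<le> b" "b = 0 \<Longrightarrow> a = 0"
  shows "xlog_ratio a b = ereal (a * ln (a / b))"
proof (cases "a = 0")
  case False
  with assms have "0 < a" "0 < b" by force+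
  then show ?thesis by (simp add: xlog_ratio_def divide_ennreal eln_ennreal)
qed (simp add: xlog_ratio_def flip: zero_ereal_def)

text \<open>This is \<open>ln z \<le> z - 1\<close> at \<open>z = b / a\<close>, multiplied by
  \<open>a\<close>. It supplies an integrable minorant of the relative entropy integrand.\<close>

lemma xlog_ratio_ge:
  assumes "0 \<le> a" "0 \<le> b"
  shows "ereal (a - b) \<le> xlog_ratio a b"
proof (cases "a = 0 \<or> b = 0")
  case True
  then show ?thesis using assms by (auto simp: xlog_ratio_def eln_def ennreal_divide_zero)
next
  case False
  with assms have "0 < a" "0 < b" by auto
  then have "ln (b / a) \<le> b / a - 1" by (intro ln_le_minus_one) auto
  then have "a * ln (b / a) \<le> a * (b / a - 1)" using \<open>0 < a\<close> by (intro mult_left_mono) auto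
  then show ?thesis using \<open>0 < a\<close> \<open>0 < b\<close>
    by (subst xlog_ratio_real) (auto simp: ln_div algebra_simps)
qed

lemma xlog_ratio_measurable [measurable (raw)]:
  assumes [measurable]: "a \<in> borel_measurable M" "b \<in> borel_measurable M"
  shows "(\<lambda>x. xlog_ratio (a x) (b x)) \<in> borel_measurable M"
  unfolding xlog_ratio_def by measurable

section \<open>Probability densities and relative entropy\<close>

lemma prob_densityD:
  assumes "prob_density M q"
  shows "q \<in> borel_measurable M" "\<And>x. x \<in> space M \<Longrightarrow> 0 \<le> q x" "prob_space (law M q)"
  using assms by (auto simp: prob_density_def)

lemma prob_density_nn_integral:
  assumes q: "prob_density M q" and G: "G \<in> sets M"
  shows "(\<integral>\<^sup>+x. ennreal (indicator G x * q x) \<partial>M) = ennreal (measure (law M q) G)"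
proof -
  interpret prob_space "law M q" using q by (rule prob_densityD)
  have "(\<integral>\<^sup>+x. ennreal (indicator G x * q x) \<partial>M) = emeasure (law M q) G"
    using prob_densityD(1)[OF q] G
    by (subst emeasure_density) (auto intro!: nn_integral_cong split: split_indicator)
  then show ?thesis by (simp add: emeasure_eq_measure)
qed

lemma prob_density_has_integral:
  assumes q: "prob_density M q" and G: "G \<in> sets M"
  shows "has_bochner_integral M (\<lambda>x. indicator G x * q x) (measure (law M q) G)"
  using prob_densityD[OF q] G prob_density_nn_integral[OF q G]
  by (intro has_bochner_integral_nn_integral) (auto split: split_indicator)

lemma prob_density_integral:
  assumes q: "prob_density M q"
  shows "integrable M q" "(\<integral>x. q x \<partial>M) = 1"
proof -
  interpret prob_space "law M q" using q by (rule prob_densityD)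
  have "has_bochner_integral M q 1"
    using prob_density_has_integral[OF q sets.top] prob_space
    by (subst has_bochner_integral_cong[OF refl _ refl, where g = "\<lambda>x. indicator (space M) x * q x"]) auto
  then show "integrable M q" "(\<integral>x. q x \<partial>M) = 1" by (auto simp: has_bochner_integral_iff)
qed

lemma measure_law_eq_0_iff:
  assumes q: "prob_density M q" and G: "G \<in> sets M"
  shows "measure (law M q) G = 0 \<longleftrightarrow> (AE x in M. x \<in> G \<longrightarrow> q x = 0)"
proof -
  interpret prob_space "law M q" using q by (rule prob_densityD)
  have "measure (law M q) G = 0 \<longleftrightarrow> (\<integral>\<^sup>+x. ennreal (indicator G x * q x) \<partial>M) = 0"
    unfolding prob_density_nn_integral[OF q G] by (simp add: ennreal_eq_0_iff order_antisym_conv)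
  also have "\<dots> \<longleftrightarrow> (AE x in M. ennreal (indicator G x * q x) = 0)"
    using prob_densityD(1)[OF q] G by (intro nn_integral_0_iff_AE) auto
  also have "\<dots> \<longleftrightarrow> (AE x in M. x \<in> G \<longrightarrow> q x = 0)"
    using prob_densityD(2)[OF q]
    by (intro AE_cong) (auto split: split_indicator simp: ennreal_eq_0_iff order_antisym_conv)
  finally show ?thesis .
qed

text \<open>Finiteness makes the integrand finite almost everywhere, and
  \<open>a log (a / 0) = \<infinity>\<close> for \<open>a > 0\<close> then excludes
  \<open>q > 0 = p\<close>. Integrability follows from the minorant \<open>q - p\<close>.\<close>

lemma rel_entropy_less_top:
  assumes q: "prob_density M q" and p: "prob_density M p" and fin: "rel_entropy M q p < \<infinity>"
  shows "AE x in M. p x = 0 \<longrightarrow> q x = 0"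
    and "integrable M (\<lambda>x. q x * ln (q x / p x))"
    and "rel_entropy M q p = ereal (\<integral>x. q x * ln (q x / p x) \<partial>M)"
proof -
  note [measurable] = prob_densityD(1)[OF q] prob_densityD(1)[OF p]
  have "(\<integral>\<^sup>+x. e2ennreal (xlog_ratio (q x) (p x)) \<partial>M) \<noteq> \<infinity>"
    using nn_integral_less_top_if_ext_integral fin unfolding rel_entropy_def by fastforce
  then have "AE x in M. e2ennreal (xlog_ratio (q x) (p x)) \<noteq> \<infinity>"
    by (intro nn_integral_PInf_AE) auto
  then show ac: "AE x in M. p x = 0 \<longrightarrow> q x = 0"
    using AE_space
  proof eventually_elim
    case (elim x)
    then have "p x = 0 \<Longrightarrow> \<not> 0 < q x"
      by (auto simp: xlog_ratio_def eln_def ennreal_divide_zero)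
    then show ?case using prob_densityD(2)[OF q elim(2)] by fastforce
  qed
  have eq: "AE x in M. xlog_ratio (q x) (p x) = ereal (q x * ln (q x / p x))"
    using ac AE_space
    by eventually_elim (use prob_densityD(2)[OF q] prob_densityD(2)[OF p] in \<open>auto intro!: xlog_ratio_real\<close>)
  then have re: "rel_entropy M q p = ext_integral M (\<lambda>x. ereal (q x * ln (q x / p x)))"
    unfolding rel_entropy_def by (rule ext_integral_cong_AE)
  show int: "integrable M (\<lambda>x. q x * ln (q x / p x))"
  proof (rule integrable_if_ext_integral_less_top)
    show "integrable M (\<lambda>x. q x - p x)"
      using prob_density_integral(1)[OF q] prob_density_integral(1)[OF p] by simp
    show "AE x in M. q x - p x \<le> q x * ln (q x / p x)"
      using eq AE_space
    proof eventually_elim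
      case (elim x)
      then show ?case
        using xlog_ratio_ge[of "q x" "p x"] prob_densityD(2)[OF q] prob_densityD(2)[OF p] by simp
    qed
  qed (use fin re in auto)
  show "rel_entropy M q p = ereal (\<integral>x. q x * ln (q x / p x) \<partial>M)"
    unfolding re by (rule ext_integral_eq_integral[OF int])
qed

section \<open>Donsker-Varadhan inequality on a two-cell partition\<close>

text \<open>The pointwise Donsker-Varadhan inequality: \<open>s\<close> is a likelihood ratio,
  \<open>w\<close> a tilt and \<open>k\<close> a normalizing constant. It is
  \<open>ln z \<le> z - 1\<close> multiplied by \<open>q\<close>, with equality exactly when
  \<open>q\<close> is the tilted posterior \<open>p * s * exp w / k\<close>.\<close>

lemma gibbs_tilt_le:
  fixes p q s w k :: real
  assumes "0 < q" "0 < p" "0 < s" "0 < k"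
  shows "q * (w - ln k + 1) - p * s * exp w / k \<le> - q * ln s + q * ln (q / p)"
proof -
  define z where "z = p * s * exp w / (k * q)"
  have "ln z \<le> z - 1" unfolding z_def using assms by (intro ln_le_minus_one) auto
  then have "q * ln z \<le> q * (z - 1)" using assms by (intro mult_left_mono) auto
  moreover have "ln z = ln p + ln s + w - ln k - ln q"
    unfolding z_def using assms by (simp add: ln_mult ln_div)
  moreover have "q * z = p * s * exp w / k" using assms by (simp add: z_def)
  ultimately show ?thesis using assms by (simp add: ln_div algebra_simps)
qed

text \<open>On \<open>q > 0\<close> each finiteness assumption excludes one degeneracy: the first
  term excludes \<open>\<rho> = 0\<close>, the evidence excludes
  \<open>\<rho> = \<infinity>\<close>, and the relative entropy excludes
  \<open>p = 0\<close>.\<close>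

lemma AE_likelihood_ratio_finite:
  fixes p q w :: "'a \<Rightarrow> real" and \<rho> :: "'a \<Rightarrow> ennreal"
  assumes p: "prob_density M p" and q: "prob_density M q"
    and \<rho>: "\<rho> \<in> borel_measurable M" and w: "w \<in> borel_measurable M" and F: "F \<in> sets M"
    and evidence: "\<And>G. G = F \<or> G = space M - F \<Longrightarrow>
      (\<integral>\<^sup>+x. \<rho> x * ennreal (indicator G x * (exp (w x) * p x)) \<partial>M) < \<infinity>"
    and fin: "ext_integral (law M q) (\<lambda>x. - eln (\<rho> x)) < \<infinity>" "rel_entropy M q p < \<infinity>"
  shows "AE x in M. 0 \<le> q x \<and> (0 < q x \<longrightarrow> 0 < p x \<and> (\<exists>s>0. \<rho> x = ennreal s))"
proof -
  note [measurable] = prob_densityD(1)[OF q] prob_densityD(1)[OF p] \<rho> w F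
  note q0 = prob_densityD(2)[OF q] and p0 = prob_densityD(2)[OF p]
  define F' where "F' = space M - F"
  have [measurable]: "F' \<in> sets M" by (simp add: F'_def)
  have "(\<integral>\<^sup>+x. e2ennreal (- eln (\<rho> x)) \<partial>law M q) \<noteq> \<infinity>"
    using nn_integral_less_top_if_ext_integral fin(1) by fastforce
  then have "AE x in law M q. e2ennreal (- eln (\<rho> x)) \<noteq> \<infinity>"
    by (intro nn_integral_PInf_AE) auto
  then have "AE x in M. 0 < q x \<longrightarrow> e2ennreal (- eln (\<rho> x)) \<noteq> \<infinity>"
    by (simp add: AE_density)
  then have \<rho>_pos: "AE x in M. 0 < q x \<longrightarrow> 0 < \<rho> x"
    by eventually_elim (auto simp: eln_def zero_less_iff_neq_zero)
  \<comment> \<open>The integrand of a finite nonnegative integral is finite almost everywhere;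
    wherever the weight \<open>exp (w x) * p x\<close> is positive, \<open>\<rho> x\<close> is then
    finite as well.\<close>
  have "AE x in M. \<rho> x * ennreal (indicator G x * (exp (w x) * p x)) \<noteq> \<infinity>" if G: "G = F \<or> G = F'" for G
  proof -
    have "(\<integral>\<^sup>+x. \<rho> x * ennreal (indicator G x * (exp (w x) * p x)) \<partial>M) \<noteq> \<infinity>"
      using evidence[of G] G by (auto simp: F'_def)
    then show ?thesis using G by (intro nn_integral_PInf_AE) auto
  qed
  from this[of F, simplified] this[of F', simplified] have \<rho>_fin: "AE x in M. 0 < q x \<longrightarrow> \<rho> x < \<infinity> \<and> 0 < p x"
    using rel_entropy_less_top(1)[OF q p fin(2)] AE_space
  proof eventually_elim
    case (elim x)
    show ?case
    proof
      assume "0 < q x"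
      with elim p0[of x] have "0 < p x" by (auto simp: less_le)
      then have "0 < exp (w x) * p x" by simp
      then show "\<rho> x < \<infinity> \<and> 0 < p x"
        using elim \<open>0 < p x\<close> by (auto simp: F'_def ennreal_mult_less_top less_top mult_le_0_iff
            split: split_indicator_asm)
    qed
  qed
  show "AE x in M. 0 \<le> q x \<and> (0 < q x \<longrightarrow> 0 < p x \<and> (\<exists>s>0. \<rho> x = ennreal s))"
    using \<rho>_pos \<rho>_fin AE_space
  proof eventually_elim
    case (elim x)
    then show ?case
      using q0[of x] by (cases "\<rho> x") (auto simp: ennreal_less_zero_iff)
  qed
qed

text \<open>The pointwise inequality \<open>gibbs_tilt_le\<close> is integrated with a normalizing
  constant chosen separately on \<open>F\<close> and on its complement. Optimizing the two constants
  independently, rather than one global constant, is what produces the binary relative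
  entropy.\<close>

lemma tilted_divergence_partition_le:
  fixes p q w :: "'a \<Rightarrow> real" and \<rho> :: "'a \<Rightarrow> ennreal"
  assumes p: "prob_density M p" and q: "prob_density M q"
    and \<rho>: "\<rho> \<in> borel_measurable M"
    and w: "w \<in> borel_measurable M" "\<And>x. x \<in> space M \<Longrightarrow> 0 \<le> w x"
    and F: "F \<in> sets M" and \<kappa>: "0 < \<kappa>"
    and evidence: "\<And>G. G = F \<or> G = space M - F \<Longrightarrow>
      (\<integral>\<^sup>+x. \<rho> x * ennreal (indicator G x * (exp (w x) * p x)) \<partial>M)
        \<le> ennreal (\<kappa> * measure (law M p) G)"
  shows "xlog_ratio (measure (law M q) (space M - F)) (measure (law M p) (space M - F))
      + xlog_ratio (1 - measure (law M q) (space M - F)) (1 - measure (law M p) (space M - F))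
      + enn2ereal (\<integral>\<^sup>+x. ennreal (w x * q x) \<partial>M)
    \<le> ext_integral (law M q) (\<lambda>x. - eln (\<rho> x)) + rel_entropy M q p + ereal (ln \<kappa>)"
proof (cases "ext_integral (law M q) (\<lambda>x. - eln (\<rho> x)) < \<infinity> \<and> rel_entropy M q p < \<infinity>")
  case False
  \<comment> \<open>In \<open>ereal\<close>, \<open>\<infinity>\<close> absorbs every summand,
    including \<open>- \<infinity>\<close>, so the bound is trivial here.\<close>
  then have "ext_integral (law M q) (\<lambda>x. - eln (\<rho> x)) + rel_entropy M q p + ereal (ln \<kappa>) = \<infinity>"
    by auto
  then show ?thesis by (metis ereal_less_eq(1))
next
  case True
  note [measurable] = prob_densityD(1)[OF q] prob_densityD(1)[OF p] \<rho> w(1) F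
  note q0 = prob_densityD(2)[OF q] and p0 = prob_densityD(2)[OF p]
  have ac: "AE x in M. p x = 0 \<longrightarrow> q x = 0"
    and f3: "integrable M (\<lambda>x. q x * ln (q x / p x))"
    and re: "rel_entropy M q p = ereal (\<integral>x. q x * ln (q x / p x) \<partial>M)"
    using rel_entropy_less_top[OF q p] True by auto
  define F' where "F' = space M - F"
  have [measurable]: "F' \<in> sets M" by (simp add: F'_def)
  define a where "a G = measure (law M q) G" for G
  define b where "b G = measure (law M p) G" for G
  interpret Q: prob_space "law M q" using q by (rule prob_densityD)
  interpret P: prob_space "law M p" using p by (rule prob_densityD)
  have aF: "a F = 1 - a F'" and bF: "b F = 1 - b F'"
    unfolding a_def b_def F'_def using Q.prob_compl[of F] P.prob_compl[of F] by simp_all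
  have a_nn: "0 \<le> a G" and b_nn: "0 \<le> b G" for G by (simp_all add: a_def b_def)
  \<comment> \<open>Absolute continuity passed from densities to cells: no cell can have
    \<open>q\<close>-mass but no \<open>p\<close>-mass.\<close>
  have ab: "a G = 0" if "b G = 0" "G \<in> sets M" for G
    using that ac unfolding a_def b_def measure_law_eq_0_iff[OF q that(2)] measure_law_eq_0_iff[OF p that(2)]
    by (auto elim: eventually_elim2)

  \<comment> \<open>The minimizer of \<open>k \<mapsto> (\<kappa> * b G) / k + a G * ln k\<close>, the cost of the pointwise tilt on \<open>G\<close>.\<close>
  define k where "k G = (if a G = 0 then 1 else \<kappa> * b G / a G)" for G
  \<comment> \<open>On a cell without \<open>q\<close>-mass the default \<open>1\<close> keeps
    \<open>k\<close> positive; on any other cell \<open>b G > 0\<close> by absolute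
    continuity.\<close>
  have k_pos: "0 < k G" if "G \<in> sets M" for G
    using ab[of G] that \<kappa> a_nn[of G] b_nn[of G] by (auto simp: k_def less_le)
  \<comment> \<open>The logarithm of the optimal constant splits into the cell's share of
    \<open>ln \<kappa>\<close> and its summand of the binary relative entropy. If
    \<open>a G = 0\<close>, both sides vanish.\<close>
  have a_ln_k: "a G * ln (k G) = a G * ln \<kappa> - a G * ln (a G / b G)" if "G \<in> sets M" for G
  proof (cases "a G = 0")
    case False
    then have "0 < a G" "0 < b G" using ab[of G] that a_nn[of G] b_nn[of G] by (auto simp: less_le)
    then show ?thesis using \<kappa> by (simp add: k_def ln_mult ln_div algebra_simps)
  qed simp
  define K where "K x = (if x \<in> F then k F else k F')" for x
  have K_pos: "0 < K x" for x by (simp add: K_def k_pos)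
  have [measurable]: "K \<in> borel_measurable M" unfolding K_def by measurable
  \<comment> \<open>The subtracted term of the tilt inequality. Setting it to \<open>0\<close> where
    \<open>q x = 0\<close> turns the pointwise bound into \<open>0 \<le> 0\<close> there and can
    only lower the integral.\<close>
  define e where "e x = (if q x = 0 then 0 else p x * enn2real (\<rho> x) * exp (w x) / K x)" for x
  have [measurable]: "e \<in> borel_measurable M" unfolding e_def by measurable
  have e_nn: "0 \<le> e x" if "x \<in> space M" for x
    using p0[OF that] K_pos[of x] by (auto simp: e_def)
  \<comment> \<open>When \<open>a G > 0\<close>, the choice of \<open>k G\<close> makes the evidence
    bound \<open>\<kappa> * b G\<close> divided by \<open>k G\<close> equal to \<open>a G\<close>.
    The two cells together then give at most \<open>a F + a F' = 1\<close>.\<close>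
  have e_le: "(\<integral>\<^sup>+x. ennreal (indicator G x * e x) \<partial>M) \<le> ennreal (a G)"
    if G: "G = F \<or> G = F'" for G
  proof -
    have GM [measurable]: "G \<in> sets M" using G by auto
    show ?thesis
    proof (cases "a G = 0")
      case True
      then have "AE x in M. x \<in> G \<longrightarrow> q x = 0"
        using measure_law_eq_0_iff[OF q GM] by (simp add: a_def)
      then have "AE x in M. ennreal (indicator G x * e x) = 0"
        by eventually_elim (auto simp: e_def split: split_indicator)
      then show ?thesis by (simp add: nn_integral_0_iff_AE cong: nn_integral_cong_AE)
    next
      case False
      have "ennreal (indicator G x * e x) \<le> ennreal (inverse (k G)) * (\<rho> x * ennreal (indicator G x * (exp (w x) * p x)))"
        if x: "x \<in> space M" for x
      proof (cases "x \<in> G \<and> q x \<noteq> 0")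
        case True
        then have "K x = k G" using G by (auto simp: K_def F'_def)
        then have "ennreal (indicator G x * e x) = ennreal (inverse (k G)) * (ennreal (enn2real (\<rho> x)) * ennreal (exp (w x) * p x))"
          using True k_pos[OF GM] p0[OF x] by (simp add: e_def field_simps flip: ennreal_mult)
        \<comment> \<open>Only an inequality, because \<open>enn2real\<close> sends
          \<open>\<infinity>\<close> to \<open>0\<close>.\<close>
        also have "\<dots> \<le> ennreal (inverse (k G)) * (\<rho> x * ennreal (exp (w x) * p x))"
          by (intro mult_left_mono mult_right_mono) (auto simp: ennreal_enn2real_if)
        finally show ?thesis using True by simp
      qed (auto simp: e_def)
      then have "(\<integral>\<^sup>+x. ennreal (indicator G x * e x) \<partial>M)
        \<le> (\<integral>\<^sup>+x. ennreal (inverse (k G)) * (\<rho> x * ennreal (indicator G x * (exp (w x) * p x))) \<partial>M)"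
        by (intro nn_integral_mono)
      also have "\<dots> = ennreal (inverse (k G)) * (\<integral>\<^sup>+x. \<rho> x * ennreal (indicator G x * (exp (w x) * p x)) \<partial>M)"
        by (intro nn_integral_cmult) measurable
      also have "\<dots> \<le> ennreal (inverse (k G)) * ennreal (\<kappa> * b G)"
        using evidence[of G] G by (intro mult_left_mono) (auto simp: b_def F'_def)
      also have "\<dots> = ennreal (a G)"
      proof -
        have "b G \<noteq> 0" using ab[OF _ GM] False by blast
        then show ?thesis
          using False \<kappa> a_nn[of G] b_nn[of G] by (simp add: k_def flip: ennreal_mult)
      qed
      finally show ?thesis .
    qed
  qed
  have "(\<integral>\<^sup>+x. ennreal (e x) \<partial>M) = (\<integral>\<^sup>+x. ennreal (indicator F x * e x) + ennreal (indicator F' x * e x) \<partial>M)"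
    by (intro nn_integral_cong) (auto simp: F'_def split: split_indicator)
  also have "\<dots> = (\<integral>\<^sup>+x. ennreal (indicator F x * e x) \<partial>M) + (\<integral>\<^sup>+x. ennreal (indicator F' x * e x) \<partial>M)"
    by (intro nn_integral_add) measurable
  also have "\<dots> \<le> ennreal (a F) + ennreal (a F')" by (intro add_mono e_le) auto
  also have "\<dots> = ennreal 1" using aF a_nn[of F] a_nn[of F'] by (metis ennreal_plus diff_add_cancel)
  finally have e_le_1: "(\<integral>\<^sup>+x. ennreal (e x) \<partial>M) \<le> ennreal 1" .
  have e_int: "integrable M e"
    using e_nn e_le_1 by (intro integrableI_nonneg) (auto simp: less_top[symmetric] top_unique)
  have e_le_1: "(\<integral>x. e x \<partial>M) \<le> 1"
    using e_le_1 e_nn by (subst integral_eq_nn_integral) (auto intro: enn2real_leI)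

  define f1 where "f1 x = - q x * ln (enn2real (\<rho> x))" for x
  have [measurable]: "f1 \<in> borel_measurable M" unfolding f1_def by measurable
  have T1: "ext_integral (law M q) (\<lambda>x. - eln (\<rho> x)) = ext_integral M (\<lambda>x. ereal (q x) * - eln (\<rho> x))"
    using q0 by (intro ext_integral_law) auto
  have good: "AE x in M. 0 \<le> q x \<and> (0 < q x \<longrightarrow> 0 < p x \<and> (\<exists>s>0. \<rho> x = ennreal s))"
    using True by (intro AE_likelihood_ratio_finite[OF p q \<rho> w(1) F] le_less_trans[OF evidence]) auto
  have "AE x in M. ereal (q x) * - eln (\<rho> x) = ereal (f1 x)"
    using good
  proof eventually_elim
    case (elim x)
    then show ?case
      by (cases "q x = 0") (auto simp: f1_def eln_ennreal simp flip: zero_ereal_def)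
  qed
  then have T1: "ext_integral (law M q) (\<lambda>x. - eln (\<rho> x)) = ext_integral M (\<lambda>x. ereal (f1 x))"
    unfolding T1 by (rule ext_integral_cong_AE)
  have ptw: "AE x in M. q x * (w x - ln (K x) + 1) - e x \<le> f1 x + q x * ln (q x / p x)"
    using good
  proof eventually_elim
    case (elim x)
    show ?case
    proof (cases "q x = 0")
      case False
      with elim obtain s where s: "0 < q x" "0 < p x" "0 < s" "\<rho> x = ennreal s" by auto
      then show ?thesis
        using gibbs_tilt_le[of "q x" "p x" s "K x" "w x"] K_pos[of x] by (simp add: f1_def e_def)
    qed (simp add: f1_def e_def)
  qed
  \<comment> \<open>\<open>K\<close> is constant on each cell, so the \<open>q\<close>-mean of
    \<open>ln K\<close> is a two-term sum weighted by the cell masses.\<close>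
  have hb: "has_bochner_integral M (\<lambda>x. q x * (1 - ln (K x)) - e x)
      ((1 - (a F * ln (k F) + a F' * ln (k F'))) - (\<integral>x. e x \<partial>M))"
  proof -
    have "has_bochner_integral M (\<lambda>x. (q x - ((indicator F x * q x) * ln (k F) + (indicator F' x * q x) * ln (k F'))) - e x)
      ((1 - (a F * ln (k F) + a F' * ln (k F'))) - (\<integral>x. e x \<partial>M))"
      unfolding a_def using prob_density_integral[OF q] e_int
      by (intro has_bochner_integral_diff has_bochner_integral_add has_bochner_integral_mult_left
          prob_density_has_integral[OF q]) (auto simp: has_bochner_integral_iff)
    then show ?thesis
      by (rule has_bochner_integral_cong[THEN iffD1, rotated -1])
        (auto simp: K_def F'_def algebra_simps)
  qed
  let ?g = "\<lambda>x. q x * (1 - ln (K x)) - e x"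
  \<comment> \<open>The minorant comes from the pointwise bound after dropping the nonnegative term
    \<open>q x * w x\<close>, whose integrability is not known yet.\<close>
  have f1: "integrable M f1"
  proof (rule integrable_if_ext_integral_less_top)
    show "integrable M (\<lambda>x. ?g x - q x * ln (q x / p x))"
      using hb f3 by (auto simp: has_bochner_integral_iff)
    show "AE x in M. ?g x - q x * ln (q x / p x) \<le> f1 x"
      using ptw AE_space
    proof eventually_elim
      case (elim x)
      then have "0 \<le> q x * w x" using q0 w(2) by simp
      with elim show ?case by (simp add: algebra_simps)
    qed
    show "ext_integral M (\<lambda>x. ereal (f1 x)) < \<infinity>" using True T1 by simp
  qed simp
  have wq_ptw: "AE x in M. w x * q x \<le> f1 x + q x * ln (q x / p x) - ?g x"
    using ptw by eventually_elim (simp add: algebra_simps)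
  have rhs_int: "integrable M (\<lambda>x. f1 x + q x * ln (q x / p x) - ?g x)"
    using f1 f3 hb by (auto simp: has_bochner_integral_iff)
  \<comment> \<open>With \<open>f1\<close> integrable, the same pointwise bound, now solved for
    \<open>w x * q x\<close>, yields an integrable majorant.\<close>
  have wq: "integrable M (\<lambda>x. w x * q x)"
  proof (rule Bochner_Integration.integrable_bound[OF rhs_int])
    show "AE x in M. norm (w x * q x) \<le> norm (f1 x + q x * ln (q x / p x) - ?g x)"
      using wq_ptw AE_space
    proof eventually_elim
      case (elim x)
      then have "0 \<le> w x * q x" using q0 w(2) by simp
      with elim show ?case by simp
    qed
  qed simp
  have "(\<integral>x. w x * q x \<partial>M) \<le> (\<integral>x. f1 x + q x * ln (q x / p x) - ?g x \<partial>M)"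
    by (intro integral_mono_AE wq rhs_int wq_ptw)
  also have "\<dots> = (\<integral>x. f1 x \<partial>M) + (\<integral>x. q x * ln (q x / p x) \<partial>M) - (\<integral>x. ?g x \<partial>M)"
    using f1 f3 hb by (auto simp: has_bochner_integral_iff)
  also have "(\<integral>x. ?g x \<partial>M) = (1 - (a F * ln (k F) + a F' * ln (k F'))) - (\<integral>x. e x \<partial>M)"
    using hb by (simp add: has_bochner_integral_iff)
  also have "a F * ln (k F) + a F' * ln (k F')
      = ln \<kappa> - (a F * ln (a F / b F) + a F' * ln (a F' / b F'))"
  proof -
    have "a F * ln \<kappa> + a F' * ln \<kappa> = ln \<kappa>"
      unfolding aF by (simp add: algebra_simps)
    then show ?thesis by (simp add: a_ln_k)
  qed
  \<comment> \<open>The mass \<open>1\<close> of \<open>q\<close>, which stems from the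
    \<open>+ 1\<close> in the tilt inequality, absorbs the integral of \<open>e\<close>.\<close>
  finally have main: "a F' * ln (a F' / b F') + a F * ln (a F / b F) + (\<integral>x. w x * q x \<partial>M)
      \<le> (\<integral>x. f1 x \<partial>M) + (\<integral>x. q x * ln (q x / p x) \<partial>M) + ln \<kappa>"
    using e_le_1 by linarith
  have wq_nn: "AE x in M. 0 \<le> w x * q x"
    using AE_space by eventually_elim (simp add: q0 w(2))
  have "(\<integral>\<^sup>+x. ennreal (w x * q x) \<partial>M) = ennreal (\<integral>x. w x * q x \<partial>M)"
    by (rule nn_integral_eq_integral[OF wq wq_nn])
  then have "enn2ereal (\<integral>\<^sup>+x. ennreal (w x * q x) \<partial>M) = ereal (\<integral>x. w x * q x \<partial>M)"
    using integral_nonneg_AE[OF wq_nn] by (simp add: enn2ereal_ennreal)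
  moreover have "xlog_ratio (a F') (b F') = ereal (a F' * ln (a F' / b F'))"
    "xlog_ratio (a F) (b F) = ereal (a F * ln (a F / b F))"
    using ab[of F] ab[of F'] by (auto intro!: xlog_ratio_real a_nn b_nn)
  ultimately show ?thesis
    using main unfolding T1 re ext_integral_eq_integral[OF f1]
    by (simp flip: aF bF a_def b_def F'_def)
qed

section \<open>Nonnegativity of the Jensen gap\<close>

text \<open>The evidence lower bound never exceeds the log-likelihood. It is Jensen's inequality for
  the logarithm, obtained from \<open>gibbs_tilt_le\<close> without tilt and with \<open>L\<close>
  as normalizing constant.\<close>

lemma ext_integral_latent_le:
  assumes a: "\<And>s. 0 \<le> a s" and L: "(\<integral>\<^sup>+s. ennreal (a s) \<partial>count_space UNIV) = ennreal L" "0 < L"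
  shows "ext_integral (count_space UNIV)
      (\<lambda>s. ereal (pmf qS s) * eln (ennreal (a s) / ennreal (pmf qS s))) \<le> ereal (ln L)"
proof -
  have ai: "has_bochner_integral (count_space UNIV) a L"
    using a L by (intro has_bochner_integral_nn_integral) auto
  have qi: "has_bochner_integral (count_space UNIV) (pmf qS) 1"
    by (simp add: has_bochner_integral_iff integral_pmf integrable_pmf)
  \<comment> \<open>A summable majorant of the integrand: \<open>a s / L\<close> and
    \<open>pmf qS s\<close> both sum to \<open>1\<close>, so the total is
    \<open>ln L\<close>.\<close>
  have "has_bochner_integral (count_space UNIV) (\<lambda>s. pmf qS s * ln L + (a s / L - pmf qS s)) (1 * ln L + (L / L - 1))"
    by (intro has_bochner_integral_add has_bochner_integral_diff has_bochner_integral_mult_left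
        has_bochner_integral_divide_zero ai qi)
  then have bound: "ext_integral (count_space UNIV) (\<lambda>s. ereal (pmf qS s * ln L + (a s / L - pmf qS s))) = ereal (ln L)"
    using L(2) by (auto simp: ext_integral_eq_integral has_bochner_integral_iff)
  have "ereal (pmf qS s) * eln (ennreal (a s) / ennreal (pmf qS s))
      \<le> ereal (pmf qS s * ln L + (a s / L - pmf qS s))" for s
  proof (cases "pmf qS s = 0 \<or> a s = 0")
    case True
    then show ?thesis
      using a[of s] L(2) pmf_nonneg[of qS s] by (auto simp: eln_def zero_ereal_def[symmetric])
  next
    case False
    then have pos: "0 < pmf qS s" "0 < a s" using a[of s] by (auto simp: less_le)
    have "pmf qS s * (0 - ln L + 1) - a s * 1 * exp 0 / L \<le> - pmf qS s * ln 1 + pmf qS s * ln (pmf qS s / a s)"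
      using pos L(2) by (intro gibbs_tilt_le) auto
    then have "pmf qS s * ln (a s / pmf qS s) \<le> pmf qS s * ln L + (a s / L - pmf qS s)"
      using pos by (simp add: ln_div algebra_simps)
    then show ?thesis using pos by (simp add: divide_ennreal eln_ennreal)
  qed
  then show ?thesis
    unfolding bound[symmetric] by (intro ext_integral_mono_AE) auto
qed

text \<open>For almost every parameter under \<open>q\<close>, the log-likelihood is finite and
  dominates the inner evidence lower bound, so the integrand compares with the zero
  function.\<close>

lemma jensen_gap_nonneg:
  assumes nn: "\<And>\<theta> s. \<theta> \<in> space \<Lambda> \<Longrightarrow> 0 \<le> cond (fst \<theta>) s y"
    and fin: "AE \<theta> in law \<Lambda> q. \<exists>l>0. likelihood cond latent \<theta> y = ennreal l"
  shows "0 \<le> jensen_gap \<Lambda> cond latent y q qS"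
proof -
  have "ext_integral (law \<Lambda> q) (\<lambda>\<theta>. ereal 0) \<le> jensen_gap \<Lambda> cond latent y q qS"
    unfolding jensen_gap_def
  proof (rule ext_integral_mono_AE)
    show "AE \<theta> in law \<Lambda> q. ereal 0 \<le> loglik cond latent y \<theta> -
       ext_integral (count_space UNIV) (\<lambda>s. ereal (pmf qS s) *
         eln (ennreal (cond (fst \<theta>) s y * pmf (latent \<theta>) s) / ennreal (pmf qS s)))"
      using fin AE_space
    proof eventually_elim
      case (elim \<theta>)
      then obtain l where l: "0 < l" "likelihood cond latent \<theta> y = ennreal l" by blast
      have "ext_integral (count_space UNIV) (\<lambda>s. ereal (pmf qS s) *
         eln (ennreal (cond (fst \<theta>) s y * pmf (latent \<theta>) s) / ennreal (pmf qS s))) \<le> ereal (ln l)"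
        using l nn[of \<theta>] elim(2) by (intro ext_integral_latent_le) (auto simp: likelihood_def)
      then show ?case
        using l by (simp add: loglik_def eln_ennreal ereal_diff_positive flip: zero_ereal_def)
    qed
  qed
  then show ?thesis by (simp add: ext_integral_def)
qed

section \<open>A Markov inequality damped by a test\<close>

text \<open>Only the damped variables \<open>(1 - \<phi>) * I i\<close> have controlled means. The
  part of the bad set on which the test rejects is charged to
  \<open>expectation \<phi>\<close>.\<close>

lemma (in prob_space) tested_markov_inequality:
  fixes I :: "'i \<Rightarrow> 'a \<Rightarrow> ennreal"
  assumes S: "finite S" and \<kappa>: "0 < \<kappa>"
    and \<phi>: "\<phi> \<in> borel_measurable M" "\<And>y. y \<in> space M \<Longrightarrow> 0 \<le> \<phi> y \<and> \<phi> y \<le> 1"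
    and I: "\<And>i. i \<in> S \<Longrightarrow> I i \<in> borel_measurable M"
    and B: "\<And>i. i \<in> S \<Longrightarrow> 0 \<le> B i"
      "\<And>i. i \<in> S \<Longrightarrow> (\<integral>\<^sup>+y. ennreal (1 - \<phi> y) * I i y \<partial>M) \<le> ennreal (B i)"
  shows "prob {y\<in>space M. \<exists>i\<in>S. ennreal (\<kappa> * B i) < I i y} \<le> expectation \<phi> + card S / \<kappa>"
proof -
  note [measurable] = \<phi>(1) I
  let ?bad = "{y\<in>space M. \<exists>i\<in>S. ennreal (\<kappa> * B i) < I i y}"
  have [measurable]: "?bad \<in> sets M"
    using S by measurable
  have int: "integrable M \<phi>"
    using \<phi>(2) by (intro integrable_const_bound[where B=1] AE_I2) auto
  have le: "indicator ?bad y \<le> ennreal (\<phi> y) + (\<Sum>i\<in>S. ennreal (1 - \<phi> y) * I i y / ennreal (\<kappa> * B i))"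
    if y: "y \<in> space M" for y
  proof (cases "y \<in> ?bad")
    case True
    then obtain i where i: "i \<in> S" "ennreal (\<kappa> * B i) < I i y" by blast
    \<comment> \<open>If \<open>B i = 0\<close>, the numerator is strictly positive and division by
      zero in \<open>ennreal\<close> gives \<open>\<infinity>\<close>.\<close>
    have one: "1 \<le> I i y / ennreal (\<kappa> * B i)"
    proof (cases "B i = 0")
      case False
      then have "0 < \<kappa> * B i" using \<kappa> B(1)[OF i(1)] by (simp add: less_le)
      then have "1 = ennreal (\<kappa> * B i) / ennreal (\<kappa> * B i)" by (auto simp: divide_ennreal)
      also have "\<dots> \<le> I i y / ennreal (\<kappa> * B i)"
        using i(2) by (intro divide_right_mono_ennreal) simp
      finally show ?thesis .
    qed (use i(2) in \<open>auto simp: ennreal_divide_zero\<close>)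
    have "1 = ennreal (\<phi> y) + ennreal (1 - \<phi> y) * 1"
      using \<phi>(2)[OF y] by (simp flip: ennreal_plus)
    also have "\<dots> \<le> ennreal (\<phi> y) + ennreal (1 - \<phi> y) * (I i y / ennreal (\<kappa> * B i))"
      by (intro add_left_mono mult_left_mono one) simp
    also have "\<dots> \<le> ennreal (\<phi> y) + (\<Sum>i\<in>S. ennreal (1 - \<phi> y) * I i y / ennreal (\<kappa> * B i))"
      unfolding ennreal_times_divide using S i(1)
      by (intro add_left_mono member_le_sum[where f = "\<lambda>i. ennreal (1 - \<phi> y) * I i y / ennreal (\<kappa> * B i)"]) auto
    finally show ?thesis using True by simp
  qed simp
  have "emeasure M ?bad = (\<integral>\<^sup>+y. indicator ?bad y \<partial>M)" by simp
  also have "\<dots> \<le> (\<integral>\<^sup>+y. ennreal (\<phi> y) + (\<Sum>i\<in>S. ennreal (1 - \<phi> y) * I i y / ennreal (\<kappa> * B i)) \<partial>M)"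
    by (intro nn_integral_mono le)
  also have "\<dots> = (\<integral>\<^sup>+y. ennreal (\<phi> y) \<partial>M) + (\<Sum>i\<in>S. (\<integral>\<^sup>+y. ennreal (1 - \<phi> y) * I i y \<partial>M) / ennreal (\<kappa> * B i))"
    by (simp add: nn_integral_add nn_integral_sum nn_integral_divide cong: sum.cong)
  also have "(\<integral>\<^sup>+y. ennreal (\<phi> y) \<partial>M) = ennreal (expectation \<phi>)"
    using int \<phi>(2) by (intro nn_integral_eq_integral) auto
  also have "(\<Sum>i\<in>S. (\<integral>\<^sup>+y. ennreal (1 - \<phi> y) * I i y \<partial>M) / ennreal (\<kappa> * B i)) \<le> (\<Sum>i\<in>S. ennreal (1 / \<kappa>))"
  proof (rule sum_mono)
    fix i assume i: "i \<in> S"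
    have "(\<integral>\<^sup>+y. ennreal (1 - \<phi> y) * I i y \<partial>M) / ennreal (\<kappa> * B i) \<le> ennreal (B i) / ennreal (\<kappa> * B i)"
      by (intro divide_right_mono_ennreal B i)
    \<comment> \<open>For \<open>B i = 0\<close> the quotient is \<open>0 / 0\<close>, which is
      \<open>0\<close> in \<open>ennreal\<close>.\<close>
    also have "\<dots> \<le> ennreal (1 / \<kappa>)"
      using B(1)[OF i] \<kappa> by (cases "B i = 0") (auto simp: divide_ennreal less_le)
    finally show "(\<integral>\<^sup>+y. ennreal (1 - \<phi> y) * I i y \<partial>M) / ennreal (\<kappa> * B i) \<le> ennreal (1 / \<kappa>)" .
  qed
  also have "(\<Sum>i\<in>S. ennreal (1 / \<kappa>)) = ennreal (card S / \<kappa>)"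
    using \<kappa> by (subst sum_ennreal) auto
  also have "ennreal (expectation \<phi>) + ennreal (card S / \<kappa>) = ennreal (expectation \<phi> + card S / \<kappa>)"
    using \<kappa> \<phi>(2) by (intro ennreal_plus[symmetric] integral_nonneg_AE AE_I2) auto
  finally have "emeasure M ?bad \<le> ennreal (expectation \<phi> + card S / \<kappa>)" by (simp add: add_left_mono)
  moreover have "0 \<le> expectation \<phi> + card S / \<kappa>"
    using \<kappa> \<phi>(2) by (intro add_nonneg_nonneg integral_nonneg_AE AE_I2) auto
  ultimately show ?thesis by (simp add: emeasure_eq_measure)
qed

section \<open>Likelihoods and tested evidence in the latent variable model\<close>

context latent_variable_model
begin

text \<open>Countability of the latent type reduces joint measurability to a fixed \<open>s\<close>.
  The joint version is what Fubini in the evidence bound requires.\<close>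

lemma likelihood_measurable_pair:
  "(\<lambda>(\<theta>, y). likelihood cond latent \<theta> y) \<in> borel_measurable (\<Lambda> \<Otimes>\<^sub>M \<nu>)"
proof -
  interpret S: sigma_finite_measure "count_space (UNIV :: 's set)"
    by (rule sigma_finite_measure_count_space)
  have [measurable]: "(\<lambda>x. ennreal (cond (fst (fst x)) s (snd x) * pmf (latent (fst x)) s))
      \<in> borel_measurable (\<Lambda> \<Otimes>\<^sub>M \<nu>)" for s
    using cond_measurable[of s] latent_measurable[of s] by (simp add: case_prod_beta')
  have "(\<lambda>(x, s). ennreal (cond (fst (fst x)) s (snd x) * pmf (latent (fst x)) s))
      \<in> borel_measurable ((\<Lambda> \<Otimes>\<^sub>M \<nu>) \<Otimes>\<^sub>M count_space UNIV)"
    unfolding case_prod_beta' by (rule measurable_compose_countable[where g = snd]) measurable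
  from S.borel_measurable_nn_integral[OF this] show ?thesis
    by (simp add: likelihood_def case_prod_beta')
qed

lemma likelihood_measurable [measurable (raw)]:
  assumes "f \<in> N \<rightarrow>\<^sub>M \<Lambda>" "g \<in> N \<rightarrow>\<^sub>M \<nu>"
  shows "(\<lambda>x. likelihood cond latent (f x) (g x)) \<in> borel_measurable N"
  using measurable_compose[OF measurable_Pair[OF assms] likelihood_measurable_pair] by simp

lemma prob_space_data_law:
  assumes \<theta>: "\<theta> \<in> space \<Lambda>"
  shows "prob_space (data_law \<nu> cond latent \<theta>)"
proof
  interpret S: sigma_finite_measure "count_space (UNIV :: 's set)"
    by (rule sigma_finite_measure_count_space)
  interpret N: sigma_finite_measure \<nu> by (rule sigma_finite_data)
  interpret pair_sigma_finite \<nu> "count_space (UNIV :: 's set)" ..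
  have cond_\<theta> [measurable]: "cond (fst \<theta>) s \<in> borel_measurable \<nu>" for s
    using measurable_compose[OF measurable_Pair1'[OF \<theta>] cond_measurable[of s]] by simp
  have [measurable]: "(\<lambda>(y, s). ennreal (cond (fst \<theta>) s y * pmf (latent \<theta>) s))
      \<in> borel_measurable (\<nu> \<Otimes>\<^sub>M count_space UNIV)"
    unfolding case_prod_beta' by (rule measurable_compose_countable[where g = snd]) measurable
  \<comment> \<open>The model makes \<open>cond\<close> a density only for \<open>s\<close> in the
    support of \<open>latent \<theta>\<close>; for other \<open>s\<close> the factor
    \<open>pmf (latent \<theta>) s\<close> is \<open>0\<close>.\<close>
  have cond_int: "(\<integral>\<^sup>+y. ennreal (cond (fst \<theta>) s y * pmf (latent \<theta>) s) \<partial>\<nu>) = ennreal (pmf (latent \<theta>) s)" for s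
  proof (cases "s \<in> set_pmf (latent \<theta>)")
    case True
    interpret C: prob_space "law \<nu> (cond (fst \<theta>) s)"
      using cond_density[OF \<theta> True] by (rule prob_densityD)
    have "(\<integral>\<^sup>+y. ennreal (cond (fst \<theta>) s y * pmf (latent \<theta>) s) \<partial>\<nu>)
        = (\<integral>\<^sup>+y. ennreal (cond (fst \<theta>) s y) * ennreal (pmf (latent \<theta>) s) \<partial>\<nu>)"
      by (intro nn_integral_cong) (simp add: ennreal_mult cond_nonneg[OF \<theta>])
    also have "\<dots> = (\<integral>\<^sup>+y. ennreal (cond (fst \<theta>) s y) \<partial>\<nu>) * ennreal (pmf (latent \<theta>) s)"
      by (intro nn_integral_multc) measurable
    also have "(\<integral>\<^sup>+y. ennreal (cond (fst \<theta>) s y) \<partial>\<nu>) = 1"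
      using C.emeasure_space_1 by (simp add: emeasure_density cong: nn_integral_cong)
    finally show ?thesis by simp
  qed (simp add: set_pmf_iff)
  have "(\<integral>\<^sup>+y. likelihood cond latent \<theta> y \<partial>\<nu>)
      = (\<integral>\<^sup>+s. (\<integral>\<^sup>+y. ennreal (cond (fst \<theta>) s y * pmf (latent \<theta>) s) \<partial>\<nu>) \<partial>count_space UNIV)"
    unfolding likelihood_def by (rule Fubini'[symmetric]) measurable
  also have "\<dots> = 1" unfolding cond_int by (simp add: nn_integral_pmf)
  finally show "emeasure (data_law \<nu> cond latent \<theta>) (space (data_law \<nu> cond latent \<theta>)) = 1"
    using \<theta> by (simp add: data_law_def emeasure_density cong: nn_integral_cong)
qed

text \<open>Total mass one excludes the value \<open>\<infinity>\<close> almost everywhere for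
  \<open>\<nu>\<close>, and a law gives no mass to the zeros of its own density.\<close>

lemma AE_likelihood_real:
  assumes \<theta>: "\<theta> \<in> space \<Lambda>"
  shows "AE y in data_law \<nu> cond latent \<theta>. \<exists>l>0. likelihood cond latent \<theta> y = ennreal l"
proof -
  interpret prob_space "data_law \<nu> cond latent \<theta>" using \<theta> by (rule prob_space_data_law)
  have "(\<integral>\<^sup>+y. likelihood cond latent \<theta> y \<partial>\<nu>) = 1"
    using emeasure_space_1 \<theta> by (simp add: data_law_def emeasure_density cong: nn_integral_cong)
  then have "AE y in \<nu>. likelihood cond latent \<theta> y \<noteq> \<infinity>"
    using \<theta> by (intro nn_integral_PInf_AE) auto
  then have "AE y in \<nu>. 0 < likelihood cond latent \<theta> y \<longrightarrow> (\<exists>l>0. likelihood cond latent \<theta> y = ennreal l)"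
  proof eventually_elim
    case (elim y)
    then show ?case
      by (cases "likelihood cond latent \<theta> y") (auto simp: ennreal_less_zero_iff)
  qed
  then show ?thesis
    unfolding data_law_def using \<theta> by (subst AE_density) auto
qed

text \<open>Taking the mean under the truth cancels the denominator. After Fubini, the error
  \<open>exp (- w \<theta>)\<close> of the test compensates the tilt \<open>exp (w \<theta>)\<close>
  at each parameter, leaving the prior mass of \<open>G\<close>.\<close>

lemma tested_evidence_le:
  assumes \<theta>s: "\<theta>s \<in> space \<Lambda>" and p: "prob_density \<Lambda> p" and G: "G \<in> sets \<Lambda>"
    and w: "w \<in> borel_measurable \<Lambda>"
    and \<phi>: "\<phi> \<in> borel_measurable \<nu>"
    and test: "\<And>\<theta>. \<theta> \<in> space \<Lambda> \<Longrightarrow>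
      (\<integral>\<^sup>+y. ennreal (1 - \<phi> y) \<partial>data_law \<nu> cond latent \<theta>) \<le> ennreal (exp (- w \<theta>))"
  shows "(\<integral>\<^sup>+y. ennreal (1 - \<phi> y) *
      (\<integral>\<^sup>+\<theta>. likelihood cond latent \<theta> y / likelihood cond latent \<theta>s y
        * ennreal (indicator G \<theta> * (exp (w \<theta>) * p \<theta>)) \<partial>\<Lambda>) \<partial>data_law \<nu> cond latent \<theta>s)
    \<le> ennreal (measure (law \<Lambda> p) G)"
proof -
  interpret N: sigma_finite_measure \<nu> by (rule sigma_finite_data)
  interpret L: sigma_finite_measure \<Lambda> by (rule sigma_finite_param)
  interpret pair_sigma_finite \<Lambda> \<nu> ..
  note [measurable] = prob_densityD(1)[OF p] G w \<phi> \<theta>s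
  let ?L = "likelihood cond latent"
  let ?W = "\<lambda>\<theta>. ennreal (indicator G \<theta> * (exp (w \<theta>) * p \<theta>))"
  have "(\<integral>\<^sup>+y. ennreal (1 - \<phi> y) * (\<integral>\<^sup>+\<theta>. ?L \<theta> y / ?L \<theta>s y * ?W \<theta> \<partial>\<Lambda>) \<partial>data_law \<nu> cond latent \<theta>s)
      = (\<integral>\<^sup>+y. ?L \<theta>s y * (ennreal (1 - \<phi> y) * (\<integral>\<^sup>+\<theta>. ?L \<theta> y / ?L \<theta>s y * ?W \<theta> \<partial>\<Lambda>)) \<partial>\<nu>)"
    unfolding data_law_def by (intro nn_integral_density) measurable
  also have "\<dots> \<le> (\<integral>\<^sup>+y. (\<integral>\<^sup>+\<theta>. ennreal (1 - \<phi> y) * ?L \<theta> y * ?W \<theta> \<partial>\<Lambda>) \<partial>\<nu>)"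
  proof (rule nn_integral_mono)
    fix y assume [measurable]: "y \<in> space \<nu>"
    \<comment> \<open>Equality can fail at \<open>x = 0\<close> and \<open>x = \<infinity>\<close>,
      where the left side is \<open>0\<close>; an upper bound suffices.\<close>
    have cancel: "x * (z / x) \<le> z" for x z :: ennreal
      by (cases "x = 0 \<or> x = \<infinity>") (auto simp: ennreal_times_divide mult.commute[of x] mult_divide_eq_ennreal)
    have "?L \<theta>s y * (ennreal (1 - \<phi> y) * (\<integral>\<^sup>+\<theta>. ?L \<theta> y / ?L \<theta>s y * ?W \<theta> \<partial>\<Lambda>))
        = (\<integral>\<^sup>+\<theta>. (?L \<theta>s y * ennreal (1 - \<phi> y)) * (?L \<theta> y / ?L \<theta>s y * ?W \<theta>) \<partial>\<Lambda>)"
      by (subst nn_integral_cmult) (auto simp: mult.assoc)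
    also have "\<dots> \<le> (\<integral>\<^sup>+\<theta>. ennreal (1 - \<phi> y) * ?L \<theta> y * ?W \<theta> \<partial>\<Lambda>)"
    proof (rule nn_integral_mono)
      fix \<theta>
      have "(?L \<theta>s y * ennreal (1 - \<phi> y)) * (?L \<theta> y / ?L \<theta>s y * ?W \<theta>)
          = ennreal (1 - \<phi> y) * (?L \<theta>s y * (?L \<theta> y / ?L \<theta>s y)) * ?W \<theta>"
        by (simp only: ac_simps)
      also have "\<dots> \<le> ennreal (1 - \<phi> y) * ?L \<theta> y * ?W \<theta>"
        by (intro mult_left_mono mult_right_mono cancel) auto
      finally show "(?L \<theta>s y * ennreal (1 - \<phi> y)) * (?L \<theta> y / ?L \<theta>s y * ?W \<theta>)
          \<le> ennreal (1 - \<phi> y) * ?L \<theta> y * ?W \<theta>" .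
    qed
    finally show "?L \<theta>s y * (ennreal (1 - \<phi> y) * (\<integral>\<^sup>+\<theta>. ?L \<theta> y / ?L \<theta>s y * ?W \<theta> \<partial>\<Lambda>))
        \<le> (\<integral>\<^sup>+\<theta>. ennreal (1 - \<phi> y) * ?L \<theta> y * ?W \<theta> \<partial>\<Lambda>)" .
  qed
  also have "\<dots> = (\<integral>\<^sup>+\<theta>. (\<integral>\<^sup>+y. ennreal (1 - \<phi> y) * ?L \<theta> y * ?W \<theta> \<partial>\<nu>) \<partial>\<Lambda>)"
    by (rule Fubini') measurable
  also have "\<dots> \<le> (\<integral>\<^sup>+\<theta>. ennreal (indicator G \<theta> * p \<theta>) \<partial>\<Lambda>)"
  proof (rule nn_integral_mono)
    fix \<theta> assume \<theta> [measurable]: "\<theta> \<in> space \<Lambda>"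
    have "(\<integral>\<^sup>+y. ennreal (1 - \<phi> y) * ?L \<theta> y * ?W \<theta> \<partial>\<nu>) = (\<integral>\<^sup>+y. ?L \<theta> y * ennreal (1 - \<phi> y) \<partial>\<nu>) * ?W \<theta>"
      by (subst nn_integral_multc[symmetric]) (auto simp: ac_simps)
    also have "(\<integral>\<^sup>+y. ?L \<theta> y * ennreal (1 - \<phi> y) \<partial>\<nu>) = (\<integral>\<^sup>+y. ennreal (1 - \<phi> y) \<partial>data_law \<nu> cond latent \<theta>)"
      unfolding data_law_def by (intro nn_integral_density[symmetric]) measurable
    also have "\<dots> * ?W \<theta> \<le> ennreal (exp (- w \<theta>)) * ?W \<theta>"
      by (intro mult_right_mono test \<theta>) simp
    also have "\<dots> = ennreal (indicator G \<theta> * p \<theta>)"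
      using prob_densityD(2)[OF p \<theta>]
      by (simp add: exp_minus field_simps flip: ennreal_mult split: split_indicator)
    finally show "(\<integral>\<^sup>+y. ennreal (1 - \<phi> y) * ?L \<theta> y * ?W \<theta> \<partial>\<nu>) \<le> ennreal (indicator G \<theta> * p \<theta>)" .
  qed
  also have "\<dots> = ennreal (measure (law \<Lambda> p) G)" by (rule prob_density_nn_integral[OF p G])
  finally show ?thesis .
qed

end

section \<open>Lower bound on the variational objective\<close>

text \<open>A finite objective has no summand equal to \<open>\<infinity>\<close>, which forces a
  positive finite likelihood \<open>q\<close>-almost everywhere. This makes the Jensen gap
  nonnegative, and dropping it leaves the right-hand side of the partition inequality.\<close>

lemma vb_objective_ge:
  fixes \<Lambda> :: "('m \<times> 'p) measure"
  assumes p: "prob_density \<Lambda> p" and q: "prob_density \<Lambda> q"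
    and nn: "\<And>\<theta> s. \<theta> \<in> space \<Lambda> \<Longrightarrow> 0 \<le> cond (fst \<theta>) s y"
    and L: "(\<lambda>\<theta>. likelihood cond latent \<theta> y) \<in> borel_measurable \<Lambda>"
    and ls: "0 < ls" "likelihood cond latent \<theta>s y = ennreal ls"
    and w: "w \<in> borel_measurable \<Lambda>" "\<And>\<theta>. \<theta> \<in> space \<Lambda> \<Longrightarrow> 0 \<le> w \<theta>"
    and F: "F \<in> sets \<Lambda>" and \<kappa>: "0 < \<kappa>"
    and evidence: "\<And>G. G = F \<or> G = space \<Lambda> - F \<Longrightarrow>
      (\<integral>\<^sup>+\<theta>. likelihood cond latent \<theta> y / likelihood cond latent \<theta>s y
          * ennreal (indicator G \<theta> * (exp (w \<theta>) * p \<theta>)) \<partial>\<Lambda>)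
        \<le> ennreal (\<kappa> * measure (law \<Lambda> p) G)"
  shows "xlog_ratio (measure (law \<Lambda> q) (space \<Lambda> - F)) (measure (law \<Lambda> p) (space \<Lambda> - F))
      + xlog_ratio (1 - measure (law \<Lambda> q) (space \<Lambda> - F)) (1 - measure (law \<Lambda> p) (space \<Lambda> - F))
      + enn2ereal (\<integral>\<^sup>+\<theta>. ennreal (w \<theta> * q \<theta>) \<partial>\<Lambda>)
    \<le> vb_objective \<Lambda> cond latent p \<theta>s y q qS + ereal (ln \<kappa>)" (is "?lhs \<le> _")
proof (cases "vb_objective \<Lambda> cond latent p \<theta>s y q qS = \<infinity>")
  case False
  let ?\<rho> = "\<lambda>\<theta>. likelihood cond latent \<theta> y / likelihood cond latent \<theta>s y"
  have lr: "- loglik_ratio cond latent y \<theta> \<theta>s = - eln (?\<rho> \<theta>)" for \<theta>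
    unfolding loglik_ratio_def loglik_def using ls by (subst eln_divide) auto
  have fin: "ext_integral (law \<Lambda> q) (\<lambda>\<theta>. - eln (?\<rho> \<theta>)) < \<infinity>" "rel_entropy \<Lambda> q p < \<infinity>"
    using False by (auto simp: vb_objective_def lr)
  have \<rho>: "?\<rho> \<in> borel_measurable \<Lambda>" using L by measurable
  have "AE \<theta> in \<Lambda>. 0 \<le> q \<theta> \<and> (0 < q \<theta> \<longrightarrow> 0 < p \<theta> \<and> (\<exists>s>0. ?\<rho> \<theta> = ennreal s))"
    by (intro AE_likelihood_ratio_finite[OF p q \<rho> w(1) F _ fin] le_less_trans[OF evidence]) auto
  then have "AE \<theta> in \<Lambda>. 0 < q \<theta> \<longrightarrow> (\<exists>l>0. likelihood cond latent \<theta> y = ennreal l)"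
  proof eventually_elim
    case (elim \<theta>)
    show ?case
    proof
      assume "0 < q \<theta>"
      with elim obtain s where "0 < s" "?\<rho> \<theta> = ennreal s" by blast
      moreover from this ls have "likelihood cond latent \<theta> y = ennreal (s * ls)"
        by (cases "likelihood cond latent \<theta> y") (auto simp: divide_ennreal ennreal_top_divide)
      ultimately show "\<exists>l>0. likelihood cond latent \<theta> y = ennreal l"
        using ls by (intro exI[of _ "s * ls"]) auto
    qed
  qed
  then have "AE \<theta> in law \<Lambda> q. \<exists>l>0. likelihood cond latent \<theta> y = ennreal l"
    using prob_densityD(1)[OF q] by (simp add: AE_density)
  then have "0 \<le> jensen_gap \<Lambda> cond latent y q qS"
    by (intro jensen_gap_nonneg nn)
  then have "ext_integral (law \<Lambda> q) (\<lambda>\<theta>. - eln (?\<rho> \<theta>)) + 0 + rel_entropy \<Lambda> q p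
      \<le> vb_objective \<Lambda> cond latent p \<theta>s y q qS"
    unfolding vb_objective_def lr by (intro add_mono order_refl)
  then have "ext_integral (law \<Lambda> q) (\<lambda>\<theta>. - eln (?\<rho> \<theta>)) + rel_entropy \<Lambda> q p + ereal (ln \<kappa>)
      \<le> vb_objective \<Lambda> cond latent p \<theta>s y q qS + ereal (ln \<kappa>)"
    by (intro add_right_mono) simp
  with tilted_divergence_partition_le[OF p q \<rho> w F \<kappa> evidence] show ?thesis
    by (rule order_trans)
qed simp

lemma ereal_divide_bound:
  fixes a b \<Psi> :: ereal and n d :: real
  assumes n: "0 < n" and le: "a + b \<le> \<Psi> + ereal d"
  shows "ereal (1 / n) * a + ereal (1 / n) * b \<le> ereal (1 / n) * \<Psi> + ereal (d / n)"
  using le n by (cases a; cases b; cases \<Psi>) (auto simp: divide_right_mono simp flip: add_divide_distrib)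

section \<open>The high-probability event and the oracle inequality\<close>

theorem theorem3p5:
  fixes \<Y> :: "'y measure"
    and n :: nat
    and \<nu> :: "(nat \<Rightarrow> 'y) measure"
    and \<Lambda> :: "('m \<times> 'p) measure"
    and cond :: "'m \<Rightarrow> 's::countable \<Rightarrow> (nat \<Rightarrow> 'y) \<Rightarrow> real"
    and latent :: "'m \<times> 'p \<Rightarrow> 's pmf"
    and p\<theta> :: "'m \<times> 'p \<Rightarrow> real"
    and \<theta>star :: "'m \<times> 'p"
    and r :: "'m \<times> 'p \<Rightarrow> 'm \<times> 'p \<Rightarrow> real"
    and c \<epsilon>n \<epsilon> :: real
    and F :: "real \<Rightarrow> ('m \<times> 'p) set"
    and \<phi> :: "real \<Rightarrow> (nat \<Rightarrow> 'y) \<Rightarrow> real"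
    and \<Gamma>\<theta> :: "('m \<times> 'p \<Rightarrow> real) set"
    and \<Gamma>S :: "'s pmf set"
    and qhat\<theta> :: "(nat \<Rightarrow> 'y) \<Rightarrow> 'm \<times> 'p \<Rightarrow> real"
    and qhatS :: "(nat \<Rightarrow> 'y) \<Rightarrow> 's pmf"
  defines "P \<equiv> data_law \<nu> cond latent"
    and "\<Psi> \<equiv> vb_objective \<Lambda> cond latent p\<theta> \<theta>star"
  assumes model: "latent_variable_model \<Y> n \<nu> \<Lambda> cond latent"
    and prior: "prob_density \<Lambda> p\<theta>"
    and truth: "\<theta>star \<in> space \<Lambda>"
    and loss_nonneg: "\<And>\<theta>. \<theta> \<in> space \<Lambda> \<Longrightarrow> 0 \<le> r \<theta> \<theta>star"
    and loss_measurable: "(\<lambda>\<theta>. r \<theta> \<theta>star) \<in> borel_measurable \<Lambda>"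
    and identifiability:
      "statistical_identifiability n (law \<Lambda> p\<theta>) P \<theta>star r c \<epsilon>n F \<phi>"
    and family: "\<And>q\<theta>. q\<theta> \<in> \<Gamma>\<theta> \<Longrightarrow> prob_density \<Lambda> q\<theta>"
    and minimizer:
      "AE y in P \<theta>star. is_arg_min (\<lambda>(q\<theta>, qS). \<Psi> y q\<theta> qS) (\<lambda>q. q \<in> \<Gamma>\<theta> \<times> \<Gamma>S) (qhat\<theta> y, qhatS y)"
    and eps: "\<epsilon>n \<le> \<epsilon>"
  shows
    "\<exists>A\<in>sets (P \<theta>star).
       1 - 2 * exp (- c * n * \<epsilon>n\<^sup>2 / 2) \<le> measure (P \<theta>star) A \<and>
       (\<forall>y\<in>A. \<forall>q\<theta>\<in>\<Gamma>\<theta>. \<forall>qS\<in>\<Gamma>S.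
          absolutely_continuous (law \<Lambda> p\<theta>) (law \<Lambda> q\<theta>) \<longrightarrow>
          (let Qhat = measure (law \<Lambda> (qhat\<theta> y)) (space \<Lambda> - F \<epsilon>);
               Prior = measure (law \<Lambda> p\<theta>) (space \<Lambda> - F \<epsilon>)
           in ereal (1 / n) * (xlog_ratio Qhat Prior + xlog_ratio (1 - Qhat) (1 - Prior))
              + ereal c * enn2ereal (\<integral>\<^sup>+\<theta>\<in>{\<theta>\<in>F \<epsilon>. \<epsilon>\<^sup>2 \<le> r \<theta> \<theta>star}. ennreal (r \<theta> \<theta>star * qhat\<theta> y \<theta>) \<partial>\<Lambda>)
              \<le> ereal (1 / n) * \<Psi> y q\<theta> qS + ereal (c * \<epsilon>n\<^sup>2 / 2 + ln 2 / n)))"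
proof -
  interpret latent_variable_model \<Y> n \<nu> \<Lambda> cond latent by (rule model)
  interpret P: prob_space "P \<theta>star"
    unfolding P_def using truth by (rule prob_space_data_law)
  have space_P [simp]: "space (P \<theta>) = space \<nu>" and sets_P [simp, measurable_cong]: "sets (P \<theta>) = sets \<nu>" for \<theta>
    by (simp_all add: P_def data_law_def)
  note [measurable] = loss_measurable truth prob_densityD(1)[OF prior]
  have c: "0 < c" and \<epsilon>n: "0 < \<epsilon>n"
    and F [measurable]: "F \<epsilon> \<in> sets \<Lambda>" and \<phi> [measurable]: "\<phi> \<epsilon> \<in> borel_measurable \<nu>"
    and \<phi>01: "\<And>y. y \<in> space \<nu> \<Longrightarrow> 0 \<le> \<phi> \<epsilon> y \<and> \<phi> \<epsilon> y \<le> 1"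
    and type1: "P.expectation (\<phi> \<epsilon>) \<le> exp (- c * n * \<epsilon>n\<^sup>2)"
    and type2: "\<And>\<theta>. \<theta> \<in> F \<epsilon> \<Longrightarrow> \<epsilon>\<^sup>2 \<le> r \<theta> \<theta>star \<Longrightarrow>
        (\<integral>y. (1 - \<phi> \<epsilon> y) \<partial>P \<theta>) \<le> exp (- c * n * r \<theta> \<theta>star)"
    using identifiability eps by (auto simp: statistical_identifiability_def cong: measurable_cong_sets)
  have n: "0 < real n" using n_pos by simp
  define U where "U = {\<theta>\<in>F \<epsilon>. \<epsilon>\<^sup>2 \<le> r \<theta> \<theta>star}"
  have F_space: "F \<epsilon> \<subseteq> space \<Lambda>" using F by (rule sets.sets_into_space)
  have U [measurable]: "U \<in> sets \<Lambda>"
  proof -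
    have "U = {\<theta>\<in>space \<Lambda>. \<theta> \<in> F \<epsilon> \<and> \<epsilon>\<^sup>2 \<le> r \<theta> \<theta>star}" using F_space by (auto simp: U_def)
    then show ?thesis by simp
  qed
  \<comment> \<open>The factor \<open>n\<close> is undone by the final division by \<open>n\<close>.
    Outside \<open>U\<close> there is no tilt, so the trivial bound \<open>1\<close> on the type II
    error is enough.\<close>
  define w where "w \<theta> = indicator U \<theta> * (c * n * r \<theta> \<theta>star)" for \<theta>
  have w_meas [measurable]: "w \<in> borel_measurable \<Lambda>" unfolding w_def by measurable
  have w_nn: "0 \<le> w \<theta>" if "\<theta> \<in> space \<Lambda>" for \<theta>
    using loss_nonneg[OF that] c by (simp add: w_def)
  define I where "I G y = (\<integral>\<^sup>+\<theta>. likelihood cond latent \<theta> y / likelihood cond latent \<theta>star y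
      * ennreal (indicator G \<theta> * (exp (w \<theta>) * p\<theta> \<theta>)) \<partial>\<Lambda>)" for G y
  define B where "B G = measure (law \<Lambda> p\<theta>) G" for G
  define S where "S = {F \<epsilon>, space \<Lambda> - F \<epsilon>}"
  have S: "finite S" "card S \<le> 2" "G \<in> S \<Longrightarrow> G \<in> sets \<Lambda>" for G
    by (auto simp: S_def card_insert_if)
  interpret L: sigma_finite_measure \<Lambda> by (rule sigma_finite_param)
  have I_meas [measurable]: "I G \<in> borel_measurable \<nu>" if "G \<in> S" for G
    using S(3)[OF that] unfolding I_def by measurable
  have test: "(\<integral>\<^sup>+y. ennreal (1 - \<phi> \<epsilon> y) \<partial>P \<theta>) \<le> ennreal (exp (- w \<theta>))" if \<theta>: "\<theta> \<in> space \<Lambda>" for \<theta>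
  proof -
    interpret T: prob_space "P \<theta>" unfolding P_def using \<theta> by (rule prob_space_data_law)
    have "integrable (P \<theta>) (\<lambda>y. 1 - \<phi> \<epsilon> y)"
      using \<phi>01 by (intro T.integrable_const_bound[where B=1] AE_I2) auto
    then have eq: "(\<integral>\<^sup>+y. ennreal (1 - \<phi> \<epsilon> y) \<partial>P \<theta>) = ennreal (\<integral>y. (1 - \<phi> \<epsilon> y) \<partial>P \<theta>)"
      using \<phi>01 by (intro nn_integral_eq_integral AE_I2) auto
    show ?thesis
    proof (cases "\<theta> \<in> U")
      case True
      then show ?thesis
        unfolding eq using type2[of \<theta>] by (intro ennreal_leI) (simp add: U_def w_def)
    next
      case False
      have "(\<integral>\<^sup>+y. ennreal (1 - \<phi> \<epsilon> y) \<partial>P \<theta>) \<le> (\<integral>\<^sup>+y. 1 \<partial>P \<theta>)"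
        using \<phi>01 by (intro nn_integral_mono) (simp add: ennreal_le_1)
      then show ?thesis using False T.emeasure_space_1 by (simp add: w_def)
    qed
  qed
  \<comment> \<open>The type I error is at most \<open>1 / t\<^sup>2\<close>, and
    \<open>ln t / n\<close> is the term \<open>c * \<epsilon>n\<^sup>2 / 2\<close> of the
    bound.\<close>
  define t where "t = exp (c * n * \<epsilon>n\<^sup>2 / 2)"
  have t: "1 \<le> t" using c n by (simp add: t_def)
  \<comment> \<open>The factor \<open>2\<close> shares the Markov budget between the two cells, each
    costing \<open>1 / (2 * t)\<close>; it reappears as \<open>ln 2 / n\<close> in the
    bound.\<close>
  define bad where "bad = {y\<in>space (P \<theta>star). \<exists>G\<in>S. ennreal ((2 * t) * B G) < I G y}"
  have bad [measurable]: "bad \<in> sets \<nu>" unfolding bad_def space_P using S(1) by measurable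
  have "P.prob bad \<le> P.expectation (\<phi> \<epsilon>) + card S / (2 * t)"
    unfolding bad_def
  proof (rule P.tested_markov_inequality)
    show "(\<integral>\<^sup>+y. ennreal (1 - \<phi> \<epsilon> y) * I G y \<partial>P \<theta>star) \<le> ennreal (B G)" if "G \<in> S" for G
      unfolding I_def P_def B_def
      using test by (intro tested_evidence_le truth prior S(3) that w_meas \<phi>) (simp add: P_def)
  qed (use S t \<phi>01 I_meas in \<open>auto simp: B_def cong: measurable_cong_sets\<close>)
  also have "\<dots> \<le> exp (- c * n * \<epsilon>n\<^sup>2) + 1 / t"
  proof (intro add_mono type1)
    have "real (card S) \<le> 2" using S(2) by simp
    then show "real (card S) / (2 * t) \<le> 1 / t" using t by (simp add: field_simps)
  qed
  also have "exp (- c * n * \<epsilon>n\<^sup>2) = 1 / t * (1 / t)"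
    by (simp add: t_def exp_minus field_simps flip: exp_add)
  also have "\<dots> \<le> 1 / t * 1" using t by (intro mult_left_mono) auto
  finally have prob_bad: "P.prob bad \<le> 2 * exp (- c * n * \<epsilon>n\<^sup>2 / 2)"
    by (simp add: t_def exp_minus field_simps)

  have "AE y in P \<theta>star. is_arg_min (\<lambda>(q\<theta>, qS). \<Psi> y q\<theta> qS) (\<lambda>q. q \<in> \<Gamma>\<theta> \<times> \<Gamma>S) (qhat\<theta> y, qhatS y)
      \<and> (\<exists>l>0. likelihood cond latent \<theta>star y = ennreal l)"
    using minimizer AE_likelihood_real[OF truth] unfolding P_def by eventually_elim blast
  \<comment> \<open>The set where minimality fails need not be measurable, so it is enclosed in a
    null set \<open>N\<close> together with the data of zero or infinite true likelihood.\<close>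
  then obtain N where N: "N \<in> null_sets (P \<theta>star)"
    "{y\<in>space (P \<theta>star). \<not> (is_arg_min (\<lambda>(q\<theta>, qS). \<Psi> y q\<theta> qS) (\<lambda>q. q \<in> \<Gamma>\<theta> \<times> \<Gamma>S) (qhat\<theta> y, qhatS y)
      \<and> (\<exists>l>0. likelihood cond latent \<theta>star y = ennreal l))} \<subseteq> N"
    unfolding eventually_ae_filter by blast
  show ?thesis
  proof (intro bexI conjI ballI impI)
    \<comment> \<open>The event avoids \<open>bad\<close> and \<open>N\<close>, neither of which
      depends on the competitor; hence the bound holds simultaneously for all
      \<open>q\<theta>\<close> and \<open>qS\<close>.\<close>
    have N_sets: "N \<in> sets \<nu>" using N(1) by (auto simp: null_sets_def)
    then show "space \<nu> - (bad \<union> N) \<in> sets (P \<theta>star)" by simp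
    have "P.prob (space \<nu> - (bad \<union> N)) = 1 - P.prob (bad \<union> N)"
      using P.prob_compl[of "bad \<union> N"] N_sets by simp
    also have "P.prob (bad \<union> N) = P.prob bad"
      using N(1) by (intro measure_Un_null_set) auto
    finally show "1 - 2 * exp (- c * n * \<epsilon>n\<^sup>2 / 2) \<le> P.prob (space \<nu> - (bad \<union> N))"
      using prob_bad by simp
  next
    fix y q\<theta> qS
    assume y: "y \<in> space \<nu> - (bad \<union> N)" and q: "q\<theta> \<in> \<Gamma>\<theta>" "qS \<in> \<Gamma>S"
    from y N(2) obtain ls where
      argmin: "is_arg_min (\<lambda>(q\<theta>, qS). \<Psi> y q\<theta> qS) (\<lambda>q. q \<in> \<Gamma>\<theta> \<times> \<Gamma>S) (qhat\<theta> y, qhatS y)"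
      and ls: "0 < ls" "likelihood cond latent \<theta>star y = ennreal ls"
      by auto
    have qhat: "prob_density \<Lambda> (qhat\<theta> y)" using argmin family by (simp add: is_arg_min_def)
    have le: "\<Psi> y (qhat\<theta> y) (qhatS y) \<le> \<Psi> y q\<theta> qS"
      using argmin q by (auto simp: is_arg_min_def not_less)
    define Qhat where "Qhat = measure (law \<Lambda> (qhat\<theta> y)) (space \<Lambda> - F \<epsilon>)"
    define Prior where "Prior = measure (law \<Lambda> p\<theta>) (space \<Lambda> - F \<epsilon>)"
    define R where "R = (\<integral>\<^sup>+\<theta>\<in>U. ennreal (r \<theta> \<theta>star * qhat\<theta> y \<theta>) \<partial>\<Lambda>)"
    have "xlog_ratio Qhat Prior + xlog_ratio (1 - Qhat) (1 - Prior)
        + enn2ereal (\<integral>\<^sup>+\<theta>. ennreal (w \<theta> * qhat\<theta> y \<theta>) \<partial>\<Lambda>)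
      \<le> \<Psi> y (qhat\<theta> y) (qhatS y) + ereal (ln (2 * t))"
      unfolding \<Psi>_def Qhat_def Prior_def
    proof (rule vb_objective_ge[OF prior qhat _ _ ls w_meas w_nn F])
      show "(\<lambda>\<theta>. likelihood cond latent \<theta> y) \<in> borel_measurable \<Lambda>"
        using y by (intro likelihood_measurable) auto
      show "(\<integral>\<^sup>+\<theta>. likelihood cond latent \<theta> y / likelihood cond latent \<theta>star y
          * ennreal (indicator G \<theta> * (exp (w \<theta>) * p\<theta> \<theta>)) \<partial>\<Lambda>)
        \<le> ennreal ((2 * t) * measure (law \<Lambda> p\<theta>) G)" if "G = F \<epsilon> \<or> G = space \<Lambda> - F \<epsilon>" for G
        using y that by (auto simp: bad_def S_def I_def B_def not_less)
    qed (use y t cond_nonneg in auto)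
    \<comment> \<open>Minimality enters only here: the lower bound was proved for the objective at
      the minimizer, which no competitor can undercut.\<close>
    also have "\<dots> \<le> \<Psi> y q\<theta> qS + ereal (ln (2 * t))"
      using le by (rule add_right_mono)
    also have "(\<integral>\<^sup>+\<theta>. ennreal (w \<theta> * qhat\<theta> y \<theta>) \<partial>\<Lambda>) = ennreal (c * n) * R"
    proof -
      note [measurable] = prob_densityD(1)[OF qhat]
      have "(\<integral>\<^sup>+\<theta>. ennreal (w \<theta> * qhat\<theta> y \<theta>) \<partial>\<Lambda>)
          = (\<integral>\<^sup>+\<theta>. ennreal (c * n) * (ennreal (r \<theta> \<theta>star * qhat\<theta> y \<theta>) * indicator U \<theta>) \<partial>\<Lambda>)"
        using c loss_nonneg prob_densityD(2)[OF qhat]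
        by (intro nn_integral_cong) (auto simp: w_def mult.assoc simp flip: ennreal_mult split: split_indicator)
      also have "\<dots> = ennreal (c * n) * R"
        unfolding R_def by (intro nn_integral_cmult) measurable
      finally show ?thesis .
    qed
    finally have "ereal (1 / n) * (xlog_ratio Qhat Prior + xlog_ratio (1 - Qhat) (1 - Prior))
        + ereal (1 / n) * enn2ereal (ennreal (c * n) * R)
      \<le> ereal (1 / n) * \<Psi> y q\<theta> qS + ereal (ln (2 * t) / n)"
      by (rule ereal_divide_bound[OF n])
    moreover have "ereal (1 / n) * enn2ereal (ennreal (c * n) * R) = ereal c * enn2ereal R"
      using c n by (simp add: times_ennreal.rep_eq enn2ereal_ennreal flip: mult.assoc)
    moreover have "ln (2 * t) / n = c * \<epsilon>n\<^sup>2 / 2 + ln 2 / n"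
      using n by (simp add: t_def ln_mult field_simps)
    ultimately show "let Qhat = measure (law \<Lambda> (qhat\<theta> y)) (space \<Lambda> - F \<epsilon>);
               Prior = measure (law \<Lambda> p\<theta>) (space \<Lambda> - F \<epsilon>)
           in ereal (1 / n) * (xlog_ratio Qhat Prior + xlog_ratio (1 - Qhat) (1 - Prior))
              + ereal c * enn2ereal (\<integral>\<^sup>+\<theta>\<in>{\<theta>\<in>F \<epsilon>. \<epsilon>\<^sup>2 \<le> r \<theta> \<theta>star}. ennreal (r \<theta> \<theta>star * qhat\<theta> y \<theta>) \<partial>\<Lambda>)
              \<le> ereal (1 / n) * \<Psi> y q\<theta> qS + ereal (c * \<epsilon>n\<^sup>2 / 2 + ln 2 / n)"
      by (simp add: Let_def Qhat_def Prior_def R_def U_def)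
  qed
qed

end
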